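(* For any $\varepsilon\in(0,1)$ and any positive integer $k$, the ranking algorithm T-Min-PPR$_{k,\varepsilon}$ is $(\varepsilon/3k)$-spam resistant on the class of all graphs $G\in\mathcal{G}$ whose worst-case mixing time satisfies $\tau_G\le 1/(3\varepsilon(3+\log_2 n))$, where $n=|V_G|$.
   Context: Graphs are finite directed graphs; every vertex with no out-edges carries a self-loop. A ranking vector on $G=(V,E)$ is $x:V\to[0,1]$ with $\sum_v x[v]=1$, and $x[A]=\sum_{v\in A}x[v]$. $\mathrm{PR}(G,c,\varepsilon)$ is the stationary distribution of the chain which with probability $1-\varepsilon$ moves to a uniformly random out-neighbour and with probability $\varepsilon$ jumps to $c$. $\mathcal{G}$: graphs whose uniform random walk is ergodic with stationary distribution $\mathcal{R}(G)$; $\tau_G=\min\{t:\forall v,\ d_{TV}(p_{t,v},\mathcal{R}(G))\le1/4\}$ where $p_{t,v}$ is the uniform walk's distribution at time $t$ from $v$. A ranking algorithm takes a graph $H$ and a non-empty trusted set $T\subseteq V_H$ and outputs a ranking vector on $H$. T-Min-PPR$_{k,\varepsilon}$: on input $(H,T)$ it chooses a subset $K\subseteq T$ of size $\min\{k,|T|\}$ depending only on $T$ (not on $H$), then a maximum-size subset $K'\subseteq K$ that is coherent in $H$ (non-empty and some vertex reachable from all its vertices), and outputs $R_{\min}(H,K',\varepsilon)=y/\|y\|_1$, $y[v]=\min_{c\in K'}\mathrm{PR}(H,c,\varepsilon)[v]$. Spam model: for a graph $G$, trusted non-empty $T_G\subseteq V_G$ and $P\subseteq V_G\setminus T_G$,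 $G_P$ is the set of graphs obtainable from $G$ by adding an arbitrary (possibly empty) set $S$ of new vertices and changing arbitrarily the out-edges of vertices in $S\cup P$; for $H\in G_P$, $S_H=V_H\setminus V_G$. A cost function is $C:V_G\setminus T_G\to[0,\infty)$ with total sum $1$ (extended additively to sets). A ranking algorithm $f$ is $\sigma$-spam resistant on a class $\mathcal{A}$ if for all $G\in\mathcal{A}$ and all non-empty $T_G\subseteq V_G$ there is a cost function $C$ such that for all $P\subseteq V_G\setminus T_G$ and all $H\in G_P$ with $f(H,T_G)[S_H\cup P]>0$, we have $C(P)/f(H,T_G)[S_H\cup P]\ge\sigma$.
   Formalization: When every vertex is trusted (T_G = V_G) no cost function with total sum 1 exists, so the claim fails literally; there the total-sum condition is dropped and the empty cost function is allowed, while for proper subsets T_G the definition is unchanged. *)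

theory Defs
  imports "HOL-Probability.Probability" "Graph_Theory.Pair_Digraph"
begin

section \<open>Finite Markov chains\<close>

text \<open>A Markov chain is given by its transition kernel; only its values on the finite state
  space \<open>V\<close> are relevant.\<close>

definition chain_dist :: "('a \<Rightarrow> 'a pmf) \<Rightarrow> nat \<Rightarrow> 'a \<Rightarrow> 'a pmf" where
  "chain_dist K t v = ((\<lambda>N. bind_pmf N K) ^^ t) (return_pmf v)"

definition is_stationary :: "'a set \<Rightarrow> ('a \<Rightarrow> 'a pmf) \<Rightarrow> 'a pmf \<Rightarrow> bool" where
  "is_stationary V K N \<longleftrightarrow> set_pmf N \<subseteq> V \<and> bind_pmf N K = N"

definition stationary_dist :: "'a set \<Rightarrow> ('a \<Rightarrow> 'a pmf) \<Rightarrow> 'a pmf" where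
  "stationary_dist V K = (THE N. is_stationary V K N)"

definition irreducible_chain :: "'a set \<Rightarrow> ('a \<Rightarrow> 'a pmf) \<Rightarrow> bool" where
  "irreducible_chain V K \<longleftrightarrow> (\<forall>u\<in>V. \<forall>v\<in>V. \<exists>t. v \<in> set_pmf (chain_dist K t u))"

definition aperiodic_chain :: "'a set \<Rightarrow> ('a \<Rightarrow> 'a pmf) \<Rightarrow> bool" where
  "aperiodic_chain V K \<longleftrightarrow> (\<forall>v\<in>V. Gcd {t. 0 < t \<and> v \<in> set_pmf (chain_dist K t v)} = 1)"

definition ergodic_chain :: "'a set \<Rightarrow> ('a \<Rightarrow> 'a pmf) \<Rightarrow> bool" where
  "ergodic_chain V K \<longleftrightarrow> irreducible_chain V K \<and> aperiodic_chain V K"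

definition tv_dist :: "'a pmf \<Rightarrow> 'a pmf \<Rightarrow> real" where
  "tv_dist p q = (SUP A. \<bar>measure_pmf.prob p A - measure_pmf.prob q A\<bar>)"

section \<open>Graphs, random walks and personalised PageRank\<close>

definition out_nbrs :: "'a pair_pre_digraph \<Rightarrow> 'a \<Rightarrow> 'a set" where
  "out_nbrs G v = parcs G `` {v}"

text \<open>Sinks carry a self-loop, i.e. every vertex has an out-edge.\<close>

definition web_graph :: "'a pair_pre_digraph \<Rightarrow> bool" where
  "web_graph G \<longleftrightarrow> pair_fin_digraph G \<and> (\<forall>v\<in>pverts G. out_nbrs G v \<noteq> {})"

definition uniform_step :: "'a pair_pre_digraph \<Rightarrow> 'a \<Rightarrow> 'a pmf" where
  "uniform_step G v = pmf_of_set (out_nbrs G v)"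

definition ppr_step :: "'a pair_pre_digraph \<Rightarrow> 'a \<Rightarrow> real \<Rightarrow> 'a \<Rightarrow> 'a pmf" where
  "ppr_step G c \<epsilon> v =
     bind_pmf (bernoulli_pmf \<epsilon>) (\<lambda>jump. if jump then return_pmf c else uniform_step G v)"

definition PR :: "'a pair_pre_digraph \<Rightarrow> 'a \<Rightarrow> real \<Rightarrow> 'a pmf" where
  "PR G c \<epsilon> = stationary_dist (pverts G) (ppr_step G c \<epsilon>)"

definition ergodic_graph :: "'a pair_pre_digraph \<Rightarrow> bool" where
  "ergodic_graph G \<longleftrightarrow> web_graph G \<and> ergodic_chain (pverts G) (uniform_step G)"

definition walk_stationary :: "'a pair_pre_digraph \<Rightarrow> 'a pmf" where
  "walk_stationary G = stationary_dist (pverts G) (uniform_step G)"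

definition mixing_time :: "'a pair_pre_digraph \<Rightarrow> nat" where
  "mixing_time G =
     (LEAST t. \<forall>v\<in>pverts G. tv_dist (chain_dist (uniform_step G) t v) (walk_stationary G) \<le> 1 / 4)"

section \<open>Ranking algorithms\<close>

definition ranking_vector :: "'a pair_pre_digraph \<Rightarrow> ('a \<Rightarrow> real) \<Rightarrow> bool" where
  "ranking_vector G x \<longleftrightarrow> (\<forall>v\<in>pverts G. 0 \<le> x v \<and> x v \<le> 1) \<and> (\<Sum>v\<in>pverts G. x v) = 1"

definition ranking_input :: "'a pair_pre_digraph \<Rightarrow> 'a set \<Rightarrow> bool" where
  "ranking_input H T \<longleftrightarrow> web_graph H \<and> T \<noteq> {} \<and> T \<subseteq> pverts H"

definition ranking_algorithm :: "('a pair_pre_digraph \<Rightarrow> 'a set \<Rightarrow> 'a \<Rightarrow> real) \<Rightarrow> bool" where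
  "ranking_algorithm f \<longleftrightarrow> (\<forall>H T. ranking_input H T \<longrightarrow> ranking_vector H (f H T))"

definition coherent :: "'a pair_pre_digraph \<Rightarrow> 'a set \<Rightarrow> bool" where
  "coherent H K \<longleftrightarrow> K \<noteq> {} \<and> (\<exists>v\<in>pverts H. \<forall>c\<in>K. reachable (with_proj H) c v)"

definition max_coherent_subset :: "'a pair_pre_digraph \<Rightarrow> 'a set \<Rightarrow> 'a set \<Rightarrow> bool" where
  "max_coherent_subset H K K' \<longleftrightarrow>
     K' \<subseteq> K \<and> coherent H K' \<and> (\<forall>L. L \<subseteq> K \<and> coherent H L \<longrightarrow> card L \<le> card K')"

definition min_PR :: "'a pair_pre_digraph \<Rightarrow> 'a set \<Rightarrow> real \<Rightarrow> 'a \<Rightarrow> real" where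
  "min_PR H K \<epsilon> v = Min ((\<lambda>c. pmf (PR H c \<epsilon>) v) ` K)"

definition R_min :: "'a pair_pre_digraph \<Rightarrow> 'a set \<Rightarrow> real \<Rightarrow> 'a \<Rightarrow> real" where
  "R_min H K \<epsilon> v = min_PR H K \<epsilon> v / (\<Sum>u\<in>pverts H. \<bar>min_PR H K \<epsilon> u\<bar>)"

text \<open>The algorithm leaves open which \<open>K\<close> and which maximum-size coherent \<open>K'\<close> are chosen;
  \<open>T_Min_PPR k \<epsilon> f\<close> says that \<open>f\<close> implements it for some admissible choices. That \<open>K\<close> depends only
  on \<open>T\<close> is expressed by the selection function \<open>sel\<close>, which does not see the graph.\<close>

definition T_Min_PPR ::
  "nat \<Rightarrow> real \<Rightarrow> ('a pair_pre_digraph \<Rightarrow> 'a set \<Rightarrow> 'a \<Rightarrow> real) \<Rightarrow> bool" where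
  "T_Min_PPR k \<epsilon> f \<longleftrightarrow>
     (\<exists>sel :: 'a set \<Rightarrow> 'a set.
        (\<forall>T. finite T \<and> T \<noteq> {} \<longrightarrow> sel T \<subseteq> T \<and> card (sel T) = min k (card T)) \<and>
        (\<forall>H T. ranking_input H T \<longrightarrow>
           (\<exists>K'. max_coherent_subset H (sel T) K' \<and> (\<forall>v\<in>pverts H. f H T v = R_min H K' \<epsilon> v))))"

section \<open>Spam resistance\<close>

definition spam_graphs :: "'a pair_pre_digraph \<Rightarrow> 'a set \<Rightarrow> 'a pair_pre_digraph set" where
  "spam_graphs G P =
     {H. web_graph H \<and> pverts G \<subseteq> pverts H \<and> (\<forall>v\<in>pverts G - P. out_nbrs H v = out_nbrs G v)}"

text \<open>If every vertex is trusted, the domain of a cost function is empty and no function on it has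
  total sum 1; in this degenerate case the empty function is admitted as a cost function.\<close>

definition cost_function :: "'a pair_pre_digraph \<Rightarrow> 'a set \<Rightarrow> ('a \<Rightarrow> real) \<Rightarrow> bool" where
  "cost_function G T C \<longleftrightarrow>
     (\<forall>v\<in>pverts G - T. 0 \<le> C v) \<and> (pverts G - T \<noteq> {} \<longrightarrow> (\<Sum>v\<in>pverts G - T. C v) = 1)"

definition spam_resistant ::
  "real \<Rightarrow> 'a pair_pre_digraph set \<Rightarrow> ('a pair_pre_digraph \<Rightarrow> 'a set \<Rightarrow> 'a \<Rightarrow> real) \<Rightarrow> bool" where
  "spam_resistant \<sigma> \<A> f \<longleftrightarrow>
     ranking_algorithm f \<and>
     (\<forall>G\<in>\<A>. \<forall>T. T \<noteq> {} \<and> T \<subseteq> pverts G \<longrightarrow>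
        (\<exists>C. cost_function G T C \<and>
           (\<forall>P H. P \<subseteq> pverts G - T \<and> H \<in> spam_graphs G P \<and>
              (\<Sum>v\<in>(pverts H - pverts G) \<union> P. f H T v) > 0 \<longrightarrow>
              (\<Sum>v\<in>P. C v) / (\<Sum>v\<in>(pverts H - pverts G) \<union> P. f H T v) \<ge> \<sigma>)))"

end

theory Submission
  imports Defs
begin

text \<open>
  Write \<open>x\<^sub>c = PR(G, c, \<epsilon>)\<close>, \<open>y\<^sub>c = PR(H, c, \<epsilon>)\<close>, \<open>V = V\<^sub>G\<close>, and let \<open>S\<close> be the set of new
  vertices. Subtracting the two stationarity equations, whose kernels agree outside \<open>P \<union> S\<close>,
  bounds both the loss \<open>\<Sum>\<^sub>V max 0 (x\<^sub>c - y\<^sub>c)\<close> and the spam mass \<open>y\<^sub>c[S \<union> P]\<close> by \<open>x\<^sub>c[P] / \<epsilon>\<close>.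

  The cost of a vertex is the average of \<open>x\<^sub>c\<close> over the selected centres \<open>c \<in> K\<close>, topped up to total
  mass 1. Put \<open>X = \<Sum>\<^sub>c\<^sub>\<in>\<^sub>K x\<^sub>c[P] \<le> k C(P)\<close>. If \<open>X \<ge> \<epsilon>/3\<close> there is nothing to prove, as a
  ranking has total mass 1. Otherwise the vector \<open>min\<^sub>c y\<^sub>c\<close> has mass at most \<open>X / \<epsilon>\<close> on \<open>S \<union> P\<close> and,
  the losses adding up to less than \<open>1/3\<close>, total mass at least \<open>2/3 - 1/3\<close>, provided that
  \<open>min\<^sub>c x\<^sub>c\<close> has mass at least \<open>2/3\<close>.

  The latter is where mixing enters. The \<open>t\<close>-step distributions from any two vertices are at total
  variation distance at most \<open>2\<^sup>-\<^sup>j\<close> for \<open>t \<ge> j \<tau>\<close>, so their pointwise minimum misses at most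
  \<open>min 1 (n 2\<^sup>-\<^sup>j)\<close> of the mass. As \<open>x\<^sub>c\<close> is the mixture of these distributions with weights
  \<open>\<epsilon> (1 - \<epsilon>)\<^sup>t\<close>, at most \<open>\<epsilon> \<tau> \<Sum>\<^sub>j min 1 (n 2\<^sup>-\<^sup>j) \<le> \<epsilon> \<tau> (3 + log\<^sub>2 n) \<le> 1/3\<close> is missing in total.
  The mixing time is defined by a \<open>LEAST\<close> operator, hence meaningful only by the convergence theorem
  for ergodic chains.
\<close>

section \<open>Additively closed sets of natural numbers\<close>

text \<open>Let \<open>d\<close> be the least positive difference of two elements. Were some
  \<open>b\<close> not a multiple of \<open>d\<close>, division with remainder would yield a smaller
  difference, so \<open>d\<close> divides the gcd and equals 1. Two consecutive elements
  \<open>a\<close> and \<open>a + 1\<close> then generate everything from \<open>a * a\<close> on.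
  Applied below to the return times of an aperiodic chain.\<close>

lemma add_closed_Gcd_1_cofinite:
  fixes A :: "nat set"
  assumes add: "\<And>a b. a \<in> A \<Longrightarrow> b \<in> A \<Longrightarrow> a + b \<in> A"
    and gcd: "Gcd A = 1" and pos: "\<And>a. a \<in> A \<Longrightarrow> 0 < a"
  obtains N where "\<And>n. N \<le> n \<Longrightarrow> n \<in> A"
proof -
  have mult: "Suc m * a \<in> A" if "a \<in> A" for a m
    using that by (induction m) (auto intro: add)
  have mult': "m * a \<in> A" if "a \<in> A" "0 < m" for a m
    using mult[OF that(1), of "m - 1"] that(2) by simp
  have "A \<noteq> {}"
    using gcd by auto
  then obtain a0 where a0: "a0 \<in> A" by auto
  define Q where "Q d \<longleftrightarrow> 0 < d \<and> (\<exists>a\<in>A. a + d \<in> A)" for d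
  have "Q a0"
    using a0 pos add unfolding Q_def by blast
  define d where "d = (LEAST d. Q d)"
  have "Q d"
    unfolding d_def by (rule LeastI) fact
  then obtain a where d0: "0 < d" and a: "a \<in> A" "a + d \<in> A"
    unfolding Q_def by auto
  have dmin: "d \<le> e" if "Q e" for e
    unfolding d_def using that by (rule Least_le)
  have "d dvd b" if b: "b \<in> A" for b
  proof (rule ccontr)
    assume "\<not> d dvd b"
    define q r where "q = b div d" and "r = b mod d"
    have r: "0 < r" "r < d" and bqr: "b = q * d + r"
      using \<open>\<not> d dvd b\<close> d0 by (auto simp: q_def r_def mod_greater_zero_iff_not_dvd)
    have 1: "b + Suc q * a \<in> A" and 2: "Suc q * (a + d) \<in> A"
      using add[OF b mult[OF a(1)]] mult[OF a(2)] by auto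
    \<comment> \<open>Taking \<open>Suc q\<close> copies cancels the \<open>q * d\<close> inside
      \<open>b\<close> and leaves \<open>d - r\<close>, which lies strictly between 0 and
      \<open>d\<close>.\<close>
    have "Suc q * (a + d) = (b + Suc q * a) + (d - r)"
      using r bqr by (simp add: algebra_simps)
    then have "Q (d - r)"
      using 1 2 r unfolding Q_def by (metis zero_less_diff)
    then show False
      using dmin r by fastforce
  qed
  then have "d dvd Gcd A" by (rule Gcd_greatest)
  then have "d = 1" using gcd by simp
  then have a1: "a + 1 \<in> A" using a by simp
  have a_pos: "0 < a" using a pos by auto
  have "n \<in> A" if "a * a \<le> n" for n
  proof -
    define q r where "q = n div a" and "r = n mod a"
    have "r < a" and n: "n = q * a + r" and "a \<le> q"
      using a_pos that by (auto simp: q_def r_def less_eq_div_iff_mult_less_eq)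
    \<comment> \<open>Replace \<open>r\<close> of the \<open>q\<close> summands \<open>a\<close> by
      \<open>a + 1\<close>; the bound \<open>a * a \<le> n\<close> forces
      \<open>r < a \<le> q\<close>, so enough summands are present.\<close>
    have eq: "n = (q - r) * a + r * (a + 1)"
      using \<open>r < a\<close> \<open>a \<le> q\<close> unfolding n by (simp add: algebra_simps diff_mult_distrib)
    have "(q - r) * a \<in> A"
      using \<open>r < a\<close> \<open>a \<le> q\<close> by (intro mult' a) auto
    then show ?thesis
      using add[OF _ mult'[OF a1, of r]] unfolding eq by (cases "r = 0") auto
  qed
  then show ?thesis by (rule that)
qed

section \<open>Finite Markov kernels\<close>

lemma chain_dist_0 [simp]: "chain_dist K 0 u = return_pmf u"
  by (simp add: chain_dist_def)

lemma chain_dist_Suc: "chain_dist K (Suc t) u = bind_pmf (chain_dist K t u) K"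
  by (simp add: chain_dist_def)

lemma chain_dist_add: "chain_dist K (s + t) u = bind_pmf (chain_dist K s u) (chain_dist K t)"
  by (induction t) (simp_all add: bind_return_pmf' chain_dist_Suc bind_assoc_pmf)

lemma set_chain_dist_trans:
  "v \<in> set_pmf (chain_dist K s u) \<Longrightarrow> w \<in> set_pmf (chain_dist K t v)
    \<Longrightarrow> w \<in> set_pmf (chain_dist K (s + t) u)"
  by (auto simp: chain_dist_add)

section \<open>The l1 distance and total variation\<close>

definition l1_dist :: "'a set \<Rightarrow> 'a pmf \<Rightarrow> 'a pmf \<Rightarrow> real" where
  "l1_dist V p q = (\<Sum>v\<in>V. \<bar>pmf p v - pmf q v\<bar>)"

lemma l1_dist_triangle: "l1_dist V p r \<le> l1_dist V p q + l1_dist V q r"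
  unfolding l1_dist_def sum.distrib[symmetric] by (intro sum_mono) linarith

lemma l1_dist_commute: "l1_dist V p q = l1_dist V q p"
  unfolding l1_dist_def by (simp add: abs_minus_commute)

lemma l1_dist_nonneg: "0 \<le> l1_dist V p q"
  unfolding l1_dist_def by (simp add: sum_nonneg)

lemma pmf_diff_le_l1_dist:
  assumes "finite V" "v \<in> V"
  shows "\<bar>pmf p v - pmf q v\<bar> \<le> l1_dist V p q"
  unfolding l1_dist_def using assms by (intro member_le_sum) auto

lemma pmf_eq_if_eq_on:
  assumes "set_pmf p \<subseteq> V" "set_pmf q \<subseteq> V" "\<And>v. v \<in> V \<Longrightarrow> pmf p v = pmf q v"
  shows "p = q"
  by (rule pmf_eqI) (metis assms set_pmf_iff subsetD)

lemma eq_if_l1_dist_le_0: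
  assumes "finite V" "set_pmf p \<subseteq> V" "set_pmf q \<subseteq> V" "l1_dist V p q \<le> 0"
  shows "p = q"
  using assms(2,3)
proof (rule pmf_eq_if_eq_on)
  fix v assume "v \<in> V"
  then show "pmf p v = pmf q v"
    using pmf_diff_le_l1_dist[OF assms(1), of v p q] assms(4) by linarith
qed

lemma l1_dist_le_2:
  assumes "finite V" "set_pmf p \<subseteq> V" "set_pmf q \<subseteq> V"
  shows "l1_dist V p q \<le> 2"
proof -
  have "l1_dist V p q \<le> (\<Sum>v\<in>V. pmf p v + pmf q v)"
    unfolding l1_dist_def by (intro sum_mono) (smt (verit) pmf_nonneg)
  also have "\<dots> = 2"
    using assms by (simp add: sum.distrib sum_pmf_eq_1)
  finally show ?thesis .
qed

lemma sum_positive_part_diff: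
  assumes "finite V" "set_pmf p \<subseteq> V" "set_pmf q \<subseteq> V"
  shows "(\<Sum>v\<in>V. max 0 (pmf p v - pmf q v)) = l1_dist V p q / 2"
proof -
  have "(\<Sum>v\<in>V. max 0 (pmf p v - pmf q v))
      = (\<Sum>v\<in>V. (\<bar>pmf p v - pmf q v\<bar> + (pmf p v - pmf q v)) / 2)"
    by (intro sum.cong) (auto simp: max_def)
  also have "\<dots> = l1_dist V p q / 2"
    using assms
    by (simp add: l1_dist_def sum_divide_distrib[symmetric] sum.distrib sum_subtractf sum_pmf_eq_1)
  finally show ?thesis .
qed

lemma bdd_above_tv:
  "bdd_above (range (\<lambda>A. \<bar>measure_pmf.prob p A - measure_pmf.prob q A\<bar>))"
proof (rule bdd_aboveI2)
  fix A show "\<bar>measure_pmf.prob p A - measure_pmf.prob q A\<bar> \<le> 1"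
    using measure_pmf.prob_le_1[of p A] measure_pmf.prob_le_1[of q A]
      measure_nonneg[of p A] measure_nonneg[of q A] by linarith
qed

text \<open>The event on which \<open>p\<close> dominates \<open>q\<close> already collects half the
  l1 distance.\<close>

lemma l1_dist_le_tv_dist:
  assumes V: "finite V" "set_pmf p \<subseteq> V" "set_pmf q \<subseteq> V"
  shows "l1_dist V p q \<le> 2 * tv_dist p q"
proof -
  define A where "A = {v\<in>V. pmf q v \<le> pmf p v}"
  have "l1_dist V p q / 2 = (\<Sum>v\<in>V. if v \<in> A then pmf p v - pmf q v else 0)"
    unfolding sum_positive_part_diff[OF V, symmetric] by (intro sum.cong) (auto simp: A_def)
  also have "\<dots> = (\<Sum>v\<in>A. pmf p v - pmf q v)"
    using V(1) by (intro sum.mono_neutral_cong_right) (auto simp: A_def)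
  also have "\<dots> = measure_pmf.prob p A - measure_pmf.prob q A"
    using V(1) by (simp add: sum_subtractf measure_measure_pmf_finite A_def)
  also have "\<dots> \<le> tv_dist p q"
    unfolding tv_dist_def by (rule cSUP_upper2[OF bdd_above_tv, of A]) auto
  finally show ?thesis by simp
qed

text \<open>Twice the sharp constant, which is harmless: the bound only serves to show that an
  ergodic chain mixes at all.\<close>

lemma tv_dist_le_l1_dist:
  assumes V: "finite V" "set_pmf p \<subseteq> V" "set_pmf q \<subseteq> V"
  shows "tv_dist p q \<le> l1_dist V p q"
  unfolding tv_dist_def
proof (rule cSUP_least)
  fix A
  have *: "measure_pmf.prob r A = (\<Sum>v\<in>V \<inter> A. pmf r v)" if "set_pmf r \<subseteq> V" for r
  proof -
    have "measure_pmf.prob r A = measure_pmf.prob r (V \<inter> A)"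
      by (rule measure_pmf.finite_measure_eq_AE) (use that in \<open>auto simp: AE_measure_pmf_iff\<close>)
    then show ?thesis using V(1) by (simp add: measure_measure_pmf_finite)
  qed
  have "\<bar>measure_pmf.prob p A - measure_pmf.prob q A\<bar> = \<bar>\<Sum>v\<in>V \<inter> A. pmf p v - pmf q v\<bar>"
    using V by (simp add: * sum_subtractf)
  also have "\<dots> \<le> (\<Sum>v\<in>V \<inter> A. \<bar>pmf p v - pmf q v\<bar>)"
    by (rule sum_abs)
  also have "\<dots> \<le> l1_dist V p q"
    unfolding l1_dist_def using V(1) by (intro sum_mono2) auto
  finally show "\<bar>measure_pmf.prob p A - measure_pmf.prob q A\<bar> \<le> l1_dist V p q" .
qed simp

lemma pmf_bind_sum:
  assumes "finite V" "set_pmf p \<subseteq> V"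
  shows "pmf (bind_pmf p Q) v = (\<Sum>u\<in>V. pmf p u * pmf (Q u) v)"
  unfolding pmf_bind using assms by (subst integral_measure_pmf[of V]) auto

text \<open>Dobrushin's contraction, by duality: pairing the difference of the images with its own
  sign pattern turns their distance into a pairing of \<open>f\<close> with \<open>h\<close>, and
  the distances between rows of \<open>Q\<close> control how much \<open>h\<close> varies.\<close>

lemma l1_dist_bind_le:
  assumes V: "finite V" "set_pmf p \<subseteq> V" "set_pmf q \<subseteq> V"
    and contr: "\<And>u w. u \<in> V \<Longrightarrow> w \<in> V \<Longrightarrow> l1_dist V (Q u) (Q w) \<le> 2 * \<delta>"
  shows "l1_dist V (bind_pmf p Q) (bind_pmf q Q) \<le> \<delta> * l1_dist V p q"
proof -
  define f where "f u = pmf p u - pmf q u" for u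
  define g where "g v = (\<Sum>u\<in>V. f u * pmf (Q u) v)" for v
  define h where "h u = (\<Sum>v\<in>V. pmf (Q u) v * sgn (g v))" for u
  \<comment> \<open>The oscillation of \<open>h\<close> on \<open>V\<close> is at most \<open>2 \<delta>\<close>, so \<open>h\<close> stays within \<open>\<delta>\<close> of the midpoint
    \<open>c\<close> of its range, and \<open>c\<close> is annihilated by the zero-sum weights \<open>f\<close>.\<close>
  define c where "c = (Max (h ` V) + Min (h ` V)) / 2"
  have V_ne: "V \<noteq> {}"
    using V(2) set_pmf_not_empty[of p] by auto
  have osc: "h u - h w \<le> 2 * \<delta>" if "u \<in> V" "w \<in> V" for u w
  proof -
    have "h u - h w = (\<Sum>v\<in>V. (pmf (Q u) v - pmf (Q w) v) * sgn (g v))"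
      by (simp add: h_def sum_subtractf left_diff_distrib)
    also have "\<dots> \<le> l1_dist V (Q u) (Q w)"
      unfolding l1_dist_def by (intro sum_mono) (auto simp: sgn_if)
    finally show ?thesis using contr[OF that] by linarith
  qed
  have "Max (h ` V) \<in> h ` V" "Min (h ` V) \<in> h ` V"
    using V(1) V_ne by simp_all
  then obtain u1 u2 where u12: "u1 \<in> V" "u2 \<in> V" "Max (h ` V) = h u1" "Min (h ` V) = h u2"
    by blast
  have h_c: "\<bar>h u - c\<bar> \<le> \<delta>" if "u \<in> V" for u
  proof -
    have "h u \<le> Max (h ` V)" "Min (h ` V) \<le> h u"
      using V(1) that by auto
    then show ?thesis
      using osc[OF u12(1,2)] u12(3,4) unfolding c_def by (simp add: abs_le_iff field_simps)
  qed
  have "l1_dist V (bind_pmf p Q) (bind_pmf q Q) = (\<Sum>v\<in>V. \<bar>g v\<bar>)"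
    using V by (simp add: l1_dist_def pmf_bind_sum g_def f_def left_diff_distrib sum_subtractf)
  also have "\<dots> = (\<Sum>v\<in>V. (\<Sum>u\<in>V. f u * pmf (Q u) v) * sgn (g v))"
    unfolding g_def[symmetric] by (simp add: abs_sgn)
  also have "\<dots> = (\<Sum>u\<in>V. f u * h u)"
    unfolding h_def sum_distrib_left sum_distrib_right by (subst sum.swap) (simp add: mult.assoc)
  also have "\<dots> = (\<Sum>u\<in>V. f u * (h u - c))"
    using V by (simp add: right_diff_distrib sum_subtractf sum_distrib_right[symmetric])
       (simp add: f_def sum_subtractf sum_pmf_eq_1)
  also have "\<dots> \<le> (\<Sum>u\<in>V. \<bar>f u\<bar> * \<delta>)"
  proof (intro sum_mono)
    fix u assume "u \<in> V"
    have "f u * (h u - c) \<le> \<bar>f u\<bar> * \<bar>h u - c\<bar>"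
      by (metis abs_ge_self abs_mult)
    also have "\<dots> \<le> \<bar>f u\<bar> * \<delta>"
      using h_c[OF \<open>u \<in> V\<close>] by (intro mult_left_mono) auto
    finally show "f u * (h u - c) \<le> \<bar>f u\<bar> * \<delta>" .
  qed
  also have "\<dots> = \<delta> * l1_dist V p q"
    by (simp add: l1_dist_def f_def sum_distrib_left mult.commute)
  finally show ?thesis .
qed

section \<open>Contraction of the iterated kernel\<close>

locale finite_kernel =
  fixes V :: "'a set" and K :: "'a \<Rightarrow> 'a pmf"
  assumes fin: "finite V" and V_ne: "V \<noteq> {}"
    and closed: "u \<in> V \<Longrightarrow> set_pmf (K u) \<subseteq> V"
begin

lemma set_bind_subset: "set_pmf p \<subseteq> V \<Longrightarrow> set_pmf (bind_pmf p K) \<subseteq> V"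
  using closed by auto

lemma set_chain_dist_subset: "u \<in> V \<Longrightarrow> set_pmf (chain_dist K t u) \<subseteq> V"
  by (induction t) (auto simp: chain_dist_Suc dest: closed)

text \<open>\<open>\<delta>\<close> bounds the Dobrushin coefficient of the \<open>t\<close>-step kernel.\<close>

definition contracts :: "nat \<Rightarrow> real \<Rightarrow> bool" where
  "contracts t \<delta> \<longleftrightarrow> (\<forall>u\<in>V. \<forall>w\<in>V. l1_dist V (chain_dist K t u) (chain_dist K t w) \<le> 2 * \<delta>)"

lemma contractsD:
  "contracts t \<delta> \<Longrightarrow> u \<in> V \<Longrightarrow> w \<in> V
    \<Longrightarrow> l1_dist V (chain_dist K t u) (chain_dist K t w) \<le> 2 * \<delta>"
  by (auto simp: contracts_def)

lemma contracts_bind: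
  assumes "contracts t \<delta>" "set_pmf p \<subseteq> V" "set_pmf q \<subseteq> V"
  shows "l1_dist V (bind_pmf p (chain_dist K t)) (bind_pmf q (chain_dist K t))
    \<le> \<delta> * l1_dist V p q"
  using fin assms(2,3) contractsD[OF assms(1)] by (rule l1_dist_bind_le)

lemma contracts_nonneg: "contracts t \<delta> \<Longrightarrow> 0 \<le> \<delta>"
  using V_ne l1_dist_nonneg unfolding contracts_def by (smt (verit) all_not_in_conv)

lemma contracts_1: "contracts t 1"
  unfolding contracts_def using l1_dist_le_2[OF fin] set_chain_dist_subset by auto

lemma contracts_add:
  assumes "contracts s \<delta>" "contracts t \<gamma>"
  shows "contracts (s + t) (\<delta> * \<gamma>)"
  unfolding contracts_def
proof (intro ballI)
  fix u w assume uw: "u \<in> V" "w \<in> V"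
  have "l1_dist V (chain_dist K (s + t) u) (chain_dist K (s + t) w)
      \<le> \<gamma> * l1_dist V (chain_dist K s u) (chain_dist K s w)"
    unfolding chain_dist_add using uw by (intro contracts_bind assms set_chain_dist_subset)
  also have "\<dots> \<le> \<gamma> * (2 * \<delta>)"
    using contractsD[OF assms(1) uw] contracts_nonneg[OF assms(2)] by (rule mult_left_mono)
  finally show "l1_dist V (chain_dist K (s + t) u) (chain_dist K (s + t) w) \<le> 2 * (\<delta> * \<gamma>)"
    by (simp add: mult_ac)
qed

text \<open>The \<open>r\<close> extra steps cost only the trivial factor 1, so any time can be
  split into whole mixing periods plus a remainder.\<close>

lemma contracts_power: "contracts t \<delta> \<Longrightarrow> contracts (j * t + r) (\<delta> ^ j)"
proof (induction j)
  case 0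
  then show ?case by (simp add: contracts_1)
next
  case (Suc j)
  then show ?case
    using contracts_add[of t \<delta> "j * t + r" "\<delta> ^ j"] by (simp add: add.assoc)
qed

end

section \<open>Convergence of ergodic chains to a unique stationary distribution\<close>

context finite_kernel
begin

lemma is_stationary_chain_dist:
  assumes "is_stationary V K p"
  shows "bind_pmf p (chain_dist K t) = p"
proof (induction t)
  case 0
  then show ?case by (simp add: bind_return_pmf')
next
  case (Suc t)
  have "bind_pmf p (chain_dist K (Suc t)) = bind_pmf (bind_pmf p (chain_dist K t)) K"
    by (simp add: chain_dist_Suc[abs_def] bind_assoc_pmf)
  then show ?case
    using Suc assms by (simp add: is_stationary_def)
qed

lemma l1_dist_stationary_le:
  assumes "contracts t \<delta>" "is_stationary V K p" "set_pmf q \<subseteq> V"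
  shows "l1_dist V (bind_pmf q (chain_dist K t)) p \<le> 2 * \<delta>"
proof -
  have p: "set_pmf p \<subseteq> V"
    using assms(2) by (simp add: is_stationary_def)
  have "l1_dist V (bind_pmf q (chain_dist K t)) p \<le> \<delta> * l1_dist V q p"
    using contracts_bind[OF assms(1,3) p] is_stationary_chain_dist[OF assms(2)] by simp
  also have "\<dots> \<le> \<delta> * 2"
    by (intro mult_left_mono l1_dist_le_2 fin assms(3) p contracts_nonneg[OF assms(1)])
  finally show ?thesis by simp
qed

text \<open>Doeblin's argument: fix one state \<open>v\<close>. By aperiodicity all large times are
  return times of \<open>v\<close>, so at a common time \<open>N\<close> every start is at
  \<open>v\<close> with probability at least some \<open>m > 0\<close>, and any two laws overlap in
  that mass.\<close>

lemma ex_contracts_less_1: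
  assumes erg: "ergodic_chain V K"
  obtains N \<delta> where "contracts N \<delta>" "\<delta> < 1"
proof -
  obtain v where v: "v \<in> V"
    using V_ne by auto
  define R where "R = {t. 0 < t \<and> v \<in> set_pmf (chain_dist K t v)}"
  have "Gcd R = 1"
    using erg v by (simp add: ergodic_chain_def aperiodic_chain_def R_def)
  then obtain N0 where N0: "\<And>n. N0 \<le> n \<Longrightarrow> n \<in> R"
    by (rule add_closed_Gcd_1_cofinite[rotated])
      (auto simp: R_def intro: set_chain_dist_trans)
  have "\<forall>u\<in>V. \<exists>t. v \<in> set_pmf (chain_dist K t u)"
    using erg v by (simp add: ergodic_chain_def irreducible_chain_def)
  then obtain T where T: "\<And>u. u \<in> V \<Longrightarrow> v \<in> set_pmf (chain_dist K (T u) u)"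
    by metis
  \<comment> \<open>The summand \<open>N0\<close> leaves, for every start \<open>u\<close>, at least
    \<open>N0\<close> steps after the visit to \<open>v\<close> at time \<open>T u\<close>, enough
    to be back at \<open>v\<close> at time \<open>N\<close>.\<close>
  define N where "N = Max (T ` V) + N0"
  define m where "m = Min ((\<lambda>u. pmf (chain_dist K N u) v) ` V)"
  have reach: "v \<in> set_pmf (chain_dist K N u)" if u: "u \<in> V" for u
  proof -
    have "T u \<le> Max (T ` V)"
      using u fin by simp
    then have le: "T u + N0 \<le> N"
      by (simp add: N_def)
    then have "v \<in> set_pmf (chain_dist K (N - T u) v)"
      using N0[of "N - T u"] by (simp add: R_def)
    then have "v \<in> set_pmf (chain_dist K (T u + (N - T u)) u)"
      by (rule set_chain_dist_trans[OF T[OF u]])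
    then show ?thesis using le by simp
  qed
  have m_pos: "0 < m"
    unfolding m_def using fin V_ne reach by (simp add: pmf_positive)
  have "contracts N (1 - m)"
    unfolding contracts_def
  proof (intro ballI)
    fix u w assume uw: "u \<in> V" "w \<in> V"
    define p q where "p = chain_dist K N u" and "q = chain_dist K N w"
    have pq: "set_pmf p \<subseteq> V" "set_pmf q \<subseteq> V"
      using uw by (auto simp: p_def q_def dest!: set_chain_dist_subset)
    have mpq: "m \<le> pmf p v" "m \<le> pmf q v"
      using fin uw by (auto simp: m_def p_def q_def intro!: Min_le)
    \<comment> \<open>At \<open>v\<close> the two laws share at least \<open>m\<close>, which lowers
      the trivial bound by \<open>2 * m\<close>.\<close>
    have "l1_dist V p q \<le> (\<Sum>x\<in>V. pmf p x + pmf q x - (if x = v then 2 * m else 0))"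
      unfolding l1_dist_def using mpq by (intro sum_mono) (smt (verit) pmf_nonneg)
    also have "\<dots> = 2 * (1 - m)"
      using fin v pq by (simp add: sum_subtractf sum.distrib sum_pmf_eq_1)
    finally show "l1_dist V (chain_dist K N u) (chain_dist K N w) \<le> 2 * (1 - m)"
      by (simp add: p_def q_def)
  qed
  then show ?thesis
    by (rule that) (use m_pos in simp)
qed

lemma ex_contracts_small:
  assumes "ergodic_chain V K" "0 < e"
  obtains N where "contracts N e"
proof -
  obtain N \<delta> where N: "contracts N \<delta>" "\<delta> < 1"
    using ex_contracts_less_1[OF assms(1)] .
  obtain j where "\<delta> ^ j < e"
    using real_arch_pow_inv[OF assms(2) N(2)] by auto
  then have "contracts (j * N) e"
    using contracts_power[OF N(1), of j 0] by (force simp: contracts_def)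
  then show ?thesis by (rule that)
qed

text \<open>After \<open>N\<close> steps with a small Dobrushin coefficient the past is nearly
  forgotten, so the laws of one walk form a Cauchy sequence in each coordinate; the limit is
  invariant by continuity of the one-step equation.\<close>

lemma ex_stationary:
  assumes erg: "ergodic_chain V K"
  obtains p where "is_stationary V K p"
proof -
  obtain u where u: "u \<in> V"
    using V_ne by auto
  let ?p = "\<lambda>t. chain_dist K t u"
  have shift: "l1_dist V (?p (r + N)) (?p (s + N)) \<le> 2 * e" if "contracts N e" for N e r s
  proof -
    have "l1_dist V (?p (r + N)) (?p (s + N)) \<le> e * l1_dist V (?p r) (?p s)"
      unfolding chain_dist_add by (intro contracts_bind that set_chain_dist_subset u)
    also have "\<dots> \<le> e * 2"
      by (intro mult_left_mono l1_dist_le_2 fin set_chain_dist_subset u contracts_nonneg[OF that])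
    finally show ?thesis by simp
  qed
  have "Cauchy (\<lambda>t. pmf (?p t) v)" if v: "v \<in> V" for v
  proof (rule metric_CauchyI)
    fix e :: real assume "0 < e"
    then obtain N where N: "contracts N (e / 4)"
      using ex_contracts_small[OF erg, of "e / 4"] by auto
    show "\<exists>M. \<forall>m\<ge>M. \<forall>n\<ge>M. dist (pmf (?p m) v) (pmf (?p n) v) < e"
    proof (intro exI allI impI)
      fix m n assume "N \<le> m" "N \<le> n"
      then have "l1_dist V (?p m) (?p n) \<le> 2 * (e / 4)"
        using shift[OF N, of "m - N" "n - N"] by simp
      then show "dist (pmf (?p m) v) (pmf (?p n) v) < e"
        using pmf_diff_le_l1_dist[OF fin v, of "?p m" "?p n"] \<open>0 < e\<close>
        by (simp add: dist_real_def)
    qed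
  qed
  then have "\<forall>v\<in>V. \<exists>l. (\<lambda>t. pmf (?p t) v) \<longlonglongrightarrow> l"
    by (simp add: Cauchy_convergent_iff convergent_def)
  then obtain l0 where l0: "\<And>v. v \<in> V \<Longrightarrow> (\<lambda>t. pmf (?p t) v) \<longlonglongrightarrow> l0 v"
    by metis
  \<comment> \<open>Zero outside \<open>V\<close>, as \<open>embed_pmf\<close> takes values on the
    whole type.\<close>
  define l where "l v = (if v \<in> V then l0 v else 0)" for v
  have l: "(\<lambda>t. pmf (?p t) v) \<longlonglongrightarrow> l v" if "v \<in> V" for v
    using l0[OF that] that by (simp add: l_def)
  have l_nonneg: "0 \<le> l v" for v
  proof (cases "v \<in> V")
    case True
    then show ?thesis by (intro LIMSEQ_le_const[OF l]) auto
  qed (simp add: l_def)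
  have "(\<lambda>t. \<Sum>v\<in>V. pmf (?p t) v) \<longlonglongrightarrow> (\<Sum>v\<in>V. l v)"
    by (intro tendsto_sum l)
  then have l_sum: "(\<Sum>v\<in>V. l v) = 1"
    using set_chain_dist_subset[OF u] fin by (simp add: sum_pmf_eq_1 LIMSEQ_const_iff)
  have "(\<integral>\<^sup>+ x. ennreal (l x) \<partial>count_space UNIV) = (\<Sum>v\<in>V. ennreal (l v))"
    by (rule nn_integral_count_space'[OF fin]) (auto simp: l_def)
  also have "\<dots> = 1"
    using l_sum by (simp add: sum_ennreal l_nonneg)
  finally have l_prob: "(\<integral>\<^sup>+ x. ennreal (l x) \<partial>count_space UNIV) = 1" .
  define p where "p = embed_pmf l"
  have pmf_p: "pmf p v = l v" for v
    unfolding p_def by (rule pmf_embed_pmf[OF l_nonneg l_prob])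
  have p_V: "set_pmf p \<subseteq> V"
    by (auto simp: set_pmf_iff pmf_p l_def split: if_splits)
  have "bind_pmf p K = p"
  proof (rule pmf_eq_if_eq_on[OF set_bind_subset[OF p_V] p_V])
    fix v assume v: "v \<in> V"
    have "(\<lambda>t. \<Sum>w\<in>V. pmf (?p t) w * pmf (K w) v) \<longlonglongrightarrow> (\<Sum>w\<in>V. l w * pmf (K w) v)"
      by (intro tendsto_sum tendsto_mult_right l)
    also have "(\<lambda>t. \<Sum>w\<in>V. pmf (?p t) w * pmf (K w) v) = (\<lambda>t. pmf (?p (Suc t)) v)"
      by (simp add: chain_dist_Suc pmf_bind_sum[OF fin set_chain_dist_subset[OF u], where Q = K])
    finally have "(\<lambda>t. pmf (?p (Suc t)) v) \<longlonglongrightarrow> pmf (bind_pmf p K) v"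
      by (simp add: pmf_bind_sum[OF fin p_V] pmf_p)
    moreover have "(\<lambda>t. pmf (?p (Suc t)) v) \<longlonglongrightarrow> pmf p v"
      using LIMSEQ_Suc[OF l[OF v]] by (simp add: pmf_p)
    ultimately show "pmf (bind_pmf p K) v = pmf p v"
      by (rule LIMSEQ_unique)
  qed
  then show ?thesis
    using p_V by (intro that) (simp add: is_stationary_def)
qed

text \<open>Both distributions are fixed by every iterate of the kernel, and the iterates contract
  arbitrarily strongly.\<close>

lemma stationary_unique:
  assumes erg: "ergodic_chain V K" and p: "is_stationary V K p" and q: "is_stationary V K q"
  shows "p = q"
proof -
  have pq: "set_pmf p \<subseteq> V" "set_pmf q \<subseteq> V"
    using p q by (auto simp: is_stationary_def)
  have "l1_dist V q p \<le> e" if "0 < e" for e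
  proof -
    obtain N where N: "contracts N (e / 2)"
      using ex_contracts_small[OF erg, of "e / 2"] \<open>0 < e\<close> by auto
    show ?thesis
      using l1_dist_stationary_le[OF N p pq(2)] is_stationary_chain_dist[OF q] by simp
  qed
  then have "l1_dist V q p \<le> 0"
    by (meson dense_ge)
  then show ?thesis
    using eq_if_l1_dist_le_0[OF fin pq(2,1)] by simp
qed

lemma stationary_dist_stationary:
  assumes "ergodic_chain V K"
  shows "is_stationary V K (stationary_dist V K)"
proof -
  obtain p where p: "is_stationary V K p"
    using ex_stationary[OF assms] .
  show ?thesis
    unfolding stationary_dist_def
    by (rule theI[where a = p]) (use p stationary_unique[OF assms _ p] in blast)+
qed

lemma ex_mixed:
  assumes erg: "ergodic_chain V K" and e: "0 < e"
  shows "\<exists>t. \<forall>v\<in>V. tv_dist (chain_dist K t v) (stationary_dist V K) \<le> e"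
proof -
  obtain N where N: "contracts N (e / 2)"
    using ex_contracts_small[OF erg, of "e / 2"] e by auto
  have st: "is_stationary V K (stationary_dist V K)"
    by (rule stationary_dist_stationary[OF erg])
  have "tv_dist (chain_dist K N v) (stationary_dist V K) \<le> e" if v: "v \<in> V" for v
  proof -
    have "tv_dist (chain_dist K N v) (stationary_dist V K)
        \<le> l1_dist V (bind_pmf (return_pmf v) (chain_dist K N)) (stationary_dist V K)"
      using tv_dist_le_l1_dist[OF fin set_chain_dist_subset[OF v]] st
      by (simp add: bind_return_pmf is_stationary_def)
    also have "\<dots> \<le> e"
      using l1_dist_stationary_le[OF N st, of "return_pmf v"] v by simp
    finally show ?thesis .
  qed
  then show ?thesis by auto
qed

text \<open>The factor 2 between total variation and l1 and the triangle inequality through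
  \<open>p\<close> each double \<open>e\<close>; the 2 built into \<open>contracts\<close> absorbs
  one of them. The threshold 1/4 of the mixing time thus becomes the coefficient 1/2.\<close>

lemma contracts_if_tv_dist_le:
  assumes "\<And>v. v \<in> V \<Longrightarrow> tv_dist (chain_dist K t v) p \<le> e" "set_pmf p \<subseteq> V"
  shows "contracts t (2 * e)"
  unfolding contracts_def
proof (intro ballI)
  fix u w assume uw: "u \<in> V" "w \<in> V"
  have *: "l1_dist V (chain_dist K t v) p \<le> 2 * e" if "v \<in> V" for v
    using l1_dist_le_tv_dist[OF fin set_chain_dist_subset[OF that] assms(2), of t] assms(1)[OF that]
    by linarith
  show "l1_dist V (chain_dist K t u) (chain_dist K t w) \<le> 2 * (2 * e)"
    using l1_dist_triangle[of V "chain_dist K t u" "chain_dist K t w" p]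
      l1_dist_commute[of V p "chain_dist K t w"] *[OF uw(1)] *[OF uw(2)] by linarith
qed

end

section \<open>Personalised PageRank on a finite graph\<close>

lemma web_graph_arcsD:
  assumes "web_graph G" "(u, v) \<in> parcs G"
  shows "u \<in> pverts G" "v \<in> pverts G"
  using assms pair_wf_digraph.in_arcsD1 pair_wf_digraph.in_arcsD2
  by (fastforce simp: web_graph_def pair_fin_digraph_def)+

lemma web_graph_finite: "web_graph G \<Longrightarrow> finite (pverts G)"
  by (auto simp: web_graph_def pair_fin_digraph_def pair_fin_digraph_axioms_def)

lemma out_nbrs_subset: "web_graph G \<Longrightarrow> out_nbrs G v \<subseteq> pverts G"
  by (auto simp: out_nbrs_def dest: web_graph_arcsD)

lemma set_uniform_step:
  assumes "web_graph G" "v \<in> pverts G"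
  shows "set_pmf (uniform_step G v) = out_nbrs G v"
  unfolding uniform_step_def 
  using assms finite_subset[OF out_nbrs_subset[OF assms(1)] web_graph_finite[OF assms(1)]]
  by (intro set_pmf_of_set) (auto simp: web_graph_def)

lemma finite_kernel_uniform_step:
  assumes "web_graph G" "pverts G \<noteq> {}"
  shows "finite_kernel (pverts G) (uniform_step G)"
  using assms by unfold_locales (auto simp: web_graph_finite set_uniform_step dest: out_nbrs_subset)

text \<open>The coin is independent of the current position, so it may be tossed first.\<close>

lemma bind_ppr_step:
  "bind_pmf p (ppr_step G c \<epsilon>) =
    bind_pmf (bernoulli_pmf \<epsilon>) (\<lambda>jump. if jump then return_pmf c else bind_pmf p (uniform_step G))"
  unfolding ppr_step_def
  by (subst bind_commute_pmf) (auto intro!: bind_pmf_cong)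

context
  fixes G :: "'a pair_pre_digraph" and c :: 'a and \<epsilon> :: real
  assumes G: "web_graph G" and c: "c \<in> pverts G" and \<epsilon>: "0 < \<epsilon>" "\<epsilon> < 1"
begin

interpretation finite_kernel "pverts G" "uniform_step G"
  using G c by (intro finite_kernel_uniform_step) auto

lemma pmf_bind_ppr_step:
  assumes "set_pmf p \<subseteq> pverts G"
  shows "pmf (bind_pmf p (ppr_step G c \<epsilon>)) v = \<epsilon> * indicator {c} v
    + (1 - \<epsilon>) * (\<Sum>u\<in>pverts G. pmf p u * pmf (uniform_step G u) v)"
proof -
  have "pmf (bind_pmf p (ppr_step G c \<epsilon>)) v
      = \<epsilon> * pmf (return_pmf c) v + (1 - \<epsilon>) * pmf (bind_pmf p (uniform_step G)) v"
    unfolding bind_ppr_step using \<epsilon> by (simp add: pmf_bind[of "bernoulli_pmf \<epsilon>"])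
  then show ?thesis
    unfolding pmf_bind_sum[OF fin assms, of "uniform_step G"] by (simp add: indicator_def)
qed

text \<open>The restart terms cancel and the walk step does not expand distances, so the distance
  shrinks by \<open>1 - \<epsilon>\<close> and must vanish. The restart alone forces this, which
  covers spammed graphs with arbitrary walks.\<close>

lemma ppr_stationary_unique:
  assumes p: "is_stationary (pverts G) (ppr_step G c \<epsilon>) p"
    and q: "is_stationary (pverts G) (ppr_step G c \<epsilon>) q"
  shows "p = q"
proof -
  have pq: "set_pmf p \<subseteq> pverts G" "set_pmf q \<subseteq> pverts G"
    using p q by (auto simp: is_stationary_def)
  let ?b = "\<lambda>p. bind_pmf p (uniform_step G)"
  have "pmf r v = \<epsilon> * indicator {c} v + (1 - \<epsilon>) * pmf (?b r) v"
    if "is_stationary (pverts G) (ppr_step G c \<epsilon>) r" for r v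
    using that pmf_bind_ppr_step[of r v] pmf_bind_sum[OF fin, of r "uniform_step G" v]
    by (simp add: is_stationary_def)
  from this[OF p] this[OF q] have "l1_dist (pverts G) p q = (1 - \<epsilon>) * l1_dist (pverts G) (?b p) (?b q)"
    unfolding l1_dist_def sum_distrib_left using \<epsilon>
    by (intro sum.cong) (simp_all add: right_diff_distrib[symmetric] abs_mult)
  also have "\<dots> \<le> (1 - \<epsilon>) * (1 * l1_dist (pverts G) p q)"
    using \<epsilon> l1_dist_le_2[OF fin closed closed] by (intro mult_left_mono l1_dist_bind_le fin pq) auto
  finally have "\<epsilon> * l1_dist (pverts G) p q \<le> 0"
    by (simp add: algebra_simps)
  then have "l1_dist (pverts G) p q \<le> 0"
    using \<epsilon> by (simp add: mult_le_0_iff)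
  then show ?thesis
    by (rule eq_if_l1_dist_le_0[OF fin pq])
qed

text \<open>A stationary distribution is the position of the walk from \<open>c\<close> at a geometric time.\<close>

lemma PR_stationary: "is_stationary (pverts G) (ppr_step G c \<epsilon>) (PR G c \<epsilon>)"
proof -
  let ?K = "uniform_step G"
  define p where "p = bind_pmf (geometric_pmf \<epsilon>) (\<lambda>t. chain_dist ?K t c)"
  have p_V: "set_pmf p \<subseteq> pverts G"
    using set_chain_dist_subset[OF c] by (auto simp: p_def)
  \<comment> \<open>Condition on the geometric time being 0; otherwise split off the last step of
    the walk.\<close>
  have "p = bind_pmf (bernoulli_pmf \<epsilon>) (\<lambda>jump. if jump then return_pmf c else bind_pmf p ?K)"
    unfolding p_def using \<epsilon>
    by (subst geometric_bind_pmf_unfold)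
      (auto simp: bind_assoc_pmf bind_map_pmf bind_return_pmf chain_dist_Suc intro!: bind_pmf_cong)
  then have p: "is_stationary (pverts G) (ppr_step G c \<epsilon>) p"
    using p_V by (simp add: is_stationary_def bind_ppr_step)
  show ?thesis
    unfolding PR_def stationary_dist_def
    by (rule theI[where a = p]) (use p ppr_stationary_unique[OF _ p] in blast)+
qed

lemma set_PR_subset: "set_pmf (PR G c \<epsilon>) \<subseteq> pverts G"
  using PR_stationary by (simp add: is_stationary_def)

lemma PR_eq:
  "pmf (PR G c \<epsilon>) v = \<epsilon> * indicator {c} v
    + (1 - \<epsilon>) * (\<Sum>u\<in>pverts G. pmf (PR G c \<epsilon>) u * pmf (uniform_step G u) v)"
proof -
  have "bind_pmf (PR G c \<epsilon>) (ppr_step G c \<epsilon>) = PR G c \<epsilon>"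
    using PR_stationary by (simp add: is_stationary_def)
  then show ?thesis
    using pmf_bind_ppr_step[OF set_PR_subset, of v] by (simp only:)
qed

text \<open>The centre has mass at least \<open>\<epsilon>\<close>, and the PageRank equation passes
  positivity along arcs. This is how coherence makes the minimum vector nonzero.\<close>

lemma PR_pos_if_reachable:
  assumes "reachable (with_proj G) c v"
  shows "0 < pmf (PR G c \<epsilon>) v"
proof -
  interpret pair_fin_digraph G
    using G by (simp add: web_graph_def)
  have step_nonneg: "0 \<le> pmf (PR G c \<epsilon>) u * pmf (uniform_step G u) v" for u v
    by simp
  show ?thesis
    using assms
  proof (induction rule: reachable_induct)
    case base
    have "0 \<le> (1 - \<epsilon>) * (\<Sum>u\<in>pverts G. pmf (PR G c \<epsilon>) u * pmf (uniform_step G u) c)"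
      using \<epsilon> by (intro mult_nonneg_nonneg sum_nonneg step_nonneg) auto
    moreover have "\<epsilon> * indicator {c} c = \<epsilon>"
      by simp
    ultimately show ?case
      using PR_eq[of c] \<epsilon> by linarith
  next
    case (step u v)
    have "(u, v) \<in> parcs G"
      using step.hyps by simp
    then have u: "u \<in> pverts G" and v: "v \<in> out_nbrs G u"
      using web_graph_arcsD[OF G] by (auto simp: out_nbrs_def)
    have "0 < pmf (uniform_step G u) v"
      using v set_uniform_step[OF G u] by (simp add: pmf_positive)
    then have "0 < (1 - \<epsilon>) * (pmf (PR G c \<epsilon>) u * pmf (uniform_step G u) v)"
      using step.IH \<epsilon> by simp
    also have "\<dots> \<le> (1 - \<epsilon>) * (\<Sum>u\<in>pverts G. pmf (PR G c \<epsilon>) u * pmf (uniform_step G u) v)"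
      using \<epsilon> by (intro mult_left_mono member_le_sum u fin step_nonneg) auto
    also have "\<dots> \<le> pmf (PR G c \<epsilon>) v"
      using PR_eq[of v] \<epsilon> by (simp add: indicator_def split: if_splits)
    finally show ?case .
  qed
qed

text \<open>Unfolding stationarity \<open>N\<close> times gives the first \<open>N\<close> terms of
  the geometric mixture plus a nonnegative remainder; the finite form avoids infinite
  series.\<close>

lemma PR_ge_partial_sum:
  "(\<Sum>t<N. \<epsilon> * (1 - \<epsilon>) ^ t * pmf (chain_dist (uniform_step G) t c) v) \<le> pmf (PR G c \<epsilon>) v"
proof -
  let ?K = "uniform_step G"
  let ?x = "PR G c \<epsilon>"
  have x: "?x = bind_pmf (bernoulli_pmf \<epsilon>) (\<lambda>jump. if jump then return_pmf c else bind_pmf ?x ?K)"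
    using PR_stationary by (simp add: is_stationary_def bind_ppr_step)
  \<comment> \<open>\<open>chain_dist\<close> appends steps at the end; here the first step is split
    off, to be merged with the step taken from \<open>?x\<close>.\<close>
  have chain_Suc: "chain_dist ?K (Suc t) u = bind_pmf (?K u) (chain_dist ?K t)" for t u
    using chain_dist_add[of ?K 1 t u] by (simp add: chain_dist_Suc bind_return_pmf)
  have unfold: "pmf (bind_pmf ?x (chain_dist ?K t)) v
      = \<epsilon> * pmf (chain_dist ?K t c) v + (1 - \<epsilon>) * pmf (bind_pmf ?x (chain_dist ?K (Suc t))) v" for t
  proof -
    have "bind_pmf ?x (chain_dist ?K t) = bind_pmf (bernoulli_pmf \<epsilon>)
        (\<lambda>jump. if jump then chain_dist ?K t c else bind_pmf ?x (chain_dist ?K (Suc t)))"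
      by (subst x) (auto simp: bind_assoc_pmf bind_return_pmf chain_Suc[abs_def] intro!: bind_pmf_cong)
    then show ?thesis
      using \<epsilon> by (simp add: pmf_bind[of "bernoulli_pmf \<epsilon>"])
  qed
  have "pmf ?x v = (\<Sum>t<N. \<epsilon> * (1 - \<epsilon>) ^ t * pmf (chain_dist ?K t c) v)
      + (1 - \<epsilon>) ^ N * pmf (bind_pmf ?x (chain_dist ?K N)) v"
  proof (induction N)
    case 0
    show ?case by (simp add: bind_return_pmf')
  next
    case (Suc N)
    then show ?case by (subst Suc) (simp add: unfold[of N] algebra_simps)
  qed
  moreover have "0 \<le> (1 - \<epsilon>) ^ N * pmf (bind_pmf ?x (chain_dist ?K N)) v"
    using \<epsilon> by simp
  ultimately show ?thesis by linarith
qed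

end

section \<open>Common mass of the PageRank vectors of a rapidly mixing graph\<close>

text \<open>Compare with one fixed centre \<open>b\<close>: what the minimum misses at a vertex is
  at most the sum over \<open>c\<close> of the positive parts of the differences between
  \<open>b\<close> and \<open>c\<close>. Each of these totals at most \<open>\<delta>\<close>, and
  there are at most \<open>card V\<close> centres.\<close>

lemma (in finite_kernel) sum_Min_chain_dist_ge:
  assumes contr: "contracts t \<delta>" and L: "L \<subseteq> V" "L \<noteq> {}"
  shows "1 - real (card V) * \<delta> \<le> (\<Sum>v\<in>V. Min ((\<lambda>c. pmf (chain_dist K t c) v) ` L))"
proof -
  let ?p = "chain_dist K t"
  have finL: "finite L"
    using L(1) fin by (rule finite_subset)
  obtain b where b: "b \<in> L"
    using L(2) by auto
  have "pmf (?p b) v - Min ((\<lambda>c. pmf (?p c) v) ` L) \<le> (\<Sum>c\<in>L. max 0 (pmf (?p b) v - pmf (?p c) v))"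
    for v
  proof -
    have "Min ((\<lambda>c. pmf (?p c) v) ` L) \<in> (\<lambda>c. pmf (?p c) v) ` L"
      using finL L(2) by (intro Min_in) auto
    then obtain m where m: "m \<in> L" "Min ((\<lambda>c. pmf (?p c) v) ` L) = pmf (?p m) v"
      by blast
    have "max 0 (pmf (?p b) v - pmf (?p m) v) \<le> (\<Sum>c\<in>L. max 0 (pmf (?p b) v - pmf (?p c) v))"
      using m(1) finL by (intro member_le_sum) auto
    then show ?thesis
      using m(2) by simp
  qed
  then have "(\<Sum>v\<in>V. pmf (?p b) v - Min ((\<lambda>c. pmf (?p c) v) ` L))
      \<le> (\<Sum>v\<in>V. \<Sum>c\<in>L. max 0 (pmf (?p b) v - pmf (?p c) v))"
    by (intro sum_mono)
  also have "\<dots> = (\<Sum>c\<in>L. \<Sum>v\<in>V. max 0 (pmf (?p b) v - pmf (?p c) v))"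
    by (rule sum.swap)
  also have "\<dots> = (\<Sum>c\<in>L. l1_dist V (?p b) (?p c) / 2)"
    using b L(1) by (intro sum.cong refl sum_positive_part_diff fin set_chain_dist_subset) auto
  also have "\<dots> \<le> (\<Sum>c\<in>L. \<delta>)"
  proof (rule sum_mono)
    fix c assume "c \<in> L"
    then show "l1_dist V (?p b) (?p c) / 2 \<le> \<delta>"
      using contractsD[OF contr, of b c] b L(1) by (auto simp: mult.commute)
  qed
  also have "\<dots> \<le> real (card V) * \<delta>"
    using contracts_nonneg[OF contr] card_mono[OF fin L(1)] by (simp add: mult_right_mono)
  finally show ?thesis
    using b L(1) sum_pmf_eq_1[OF fin set_chain_dist_subset, of b t] by (auto simp: sum_subtractf)
qed

text \<open>The first \<open>m\<close> terms are at most 1 each; from index \<open>m\<close> on, the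
  terms lie below the geometric series with sum 2.\<close>

lemma sum_min_1_geometric_le:
  assumes "x \<le> 2 ^ m" "0 \<le> x"
  shows "(\<Sum>j<s. min 1 (x * (1 / 2) ^ j)) \<le> real m + 2"
proof -
  let ?a = "\<lambda>j. min 1 (x * (1 / 2 :: real) ^ j)"
  \<comment> \<open>Lengthening the range to \<open>m + s\<close> lets it be split at
    \<open>m\<close> even if \<open>s < m\<close>.\<close>
  have "sum ?a {..<s} \<le> sum ?a {..<m + s}"
    using assms(2) by (intro sum_mono2) auto
  also have "\<dots> = sum ?a {..<m} + (\<Sum>i<s. ?a (m + i))"
    by (induction s) (simp_all add: algebra_simps)
  also have "sum ?a {..<m} \<le> (\<Sum>j<m. 1)"
    by (intro sum_mono) simp
  also have "(\<Sum>i<s. ?a (m + i)) \<le> (\<Sum>i<s. (1 / 2) ^ i)"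
  proof (intro sum_mono)
    fix i
    have "x * (1 / 2) ^ (m + i) \<le> 2 ^ m * (1 / 2) ^ (m + i)"
      using assms(1) by (intro mult_right_mono) auto
    also have "\<dots> = (1 / 2) ^ i"
      by (simp add: power_add power_one_over)
    finally show "?a (m + i) \<le> (1 / 2) ^ i"
      by simp
  qed
  also have "(\<Sum>i<s. (1 / 2 :: real) ^ i) \<le> 2"
    by (simp add: sum_gp_strict)
  finally show ?thesis by simp
qed

lemma min_PR_nonneg:
  assumes "finite L" "L \<noteq> {}"
  shows "0 \<le> min_PR G L \<epsilon> v"
  unfolding min_PR_def using assms by (subst Min_ge_iff) auto

text \<open>The constant 3 is 2 from the geometric tail plus 1 from rounding the logarithm up to
  \<open>m\<close>. The mixture is truncated at multiples of \<open>\<tau>\<close>, and the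
  truncation error vanishes in the limit.\<close>

lemma sum_min_PR_ge:
  fixes \<epsilon> :: real
  assumes G: "web_graph G" and \<epsilon>: "0 < \<epsilon>" "\<epsilon> < 1"
    and L: "L \<subseteq> pverts G" "L \<noteq> {}" and \<tau>: "0 < \<tau>"
    and contr: "finite_kernel.contracts (pverts G) (uniform_step G) \<tau> (1 / 2)"
  shows "1 - \<epsilon> * real \<tau> * (3 + log 2 (real (card (pverts G)))) \<le> (\<Sum>v\<in>pverts G. min_PR G L \<epsilon> v)"
proof -
  interpret finite_kernel "pverts G" "uniform_step G"
    using G L by (intro finite_kernel_uniform_step) auto
  let ?V = "pverts G" and ?p = "chain_dist (uniform_step G)"
  define n where "n = card ?V"
  define A where "A = (\<Sum>v\<in>?V. min_PR G L \<epsilon> v)"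
  define m where "m = nat \<lceil>log 2 (real n)\<rceil>"
  have n: "1 \<le> n"
    using fin V_ne by (simp add: n_def Suc_le_eq card_gt_0_iff)
  then have log_nonneg: "0 \<le> log 2 (real n)"
    by simp
  have m_ge: "log 2 (real n) \<le> real m" and m_le: "real m \<le> log 2 (real n) + 1"
    using log_nonneg by (simp_all add: m_def)
  have n_le: "real n \<le> 2 ^ m"
    using m_ge n by (simp add: log_le_iff powr_realpow)
  have finL: "finite L"
    using L(1) fin by (rule finite_subset)
  define M where "M t v = Min ((\<lambda>c. pmf (?p t c) v) ` L)" for t v
  define e where "e t = min 1 (real n * (1 / 2) ^ (t div \<tau>))" for t
  have M_nonneg: "0 \<le> M t v" for t v
    unfolding M_def using finL L(2) by (subst Min_ge_iff) auto
  have mass_t: "1 - e t \<le> (\<Sum>v\<in>?V. M t v)" for t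
  proof -
    have "contracts t ((1 / 2) ^ (t div \<tau>))"
      using contracts_power[OF contr, of "t div \<tau>" "t mod \<tau>"] by simp
    from sum_Min_chain_dist_ge[OF this L] have "1 - real n * (1 / 2) ^ (t div \<tau>) \<le> (\<Sum>v\<in>?V. M t v)"
      by (simp add: M_def n_def)
    moreover have "0 \<le> (\<Sum>v\<in>?V. M t v)"
      by (intro sum_nonneg M_nonneg)
    ultimately show ?thesis
      by (simp add: e_def min_def)
  qed
  have sum_e: "(\<Sum>t<s * \<tau>. e t) \<le> real \<tau> * (real m + 2)" for s
  proof -
    \<comment> \<open>Group the times into blocks of length \<open>\<tau>\<close>, on which the
      error is constant.\<close>
    have "(\<Sum>t<s * \<tau>. e t) = (\<Sum>j<s. \<Sum>t\<in>{j * \<tau>..<j * \<tau> + \<tau>}. e t)"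
      by (rule sum.nat_group[symmetric])
    also have "\<dots> = (\<Sum>j<s. real \<tau> * min 1 (real n * (1 / 2) ^ j))"
    proof (intro sum.cong refl)
      fix j
      have "(\<Sum>t\<in>{j * \<tau>..<j * \<tau> + \<tau>}. e t)
          = (\<Sum>t\<in>{j * \<tau>..<j * \<tau> + \<tau>}. min 1 (real n * (1 / 2) ^ j))"
      proof (intro sum.cong refl)
        fix t assume "t \<in> {j * \<tau>..<j * \<tau> + \<tau>}"
        then have "t div \<tau> = j"
          by (intro div_nat_eqI) (auto simp: mult.commute)
        then show "e t = min 1 (real n * (1 / 2) ^ j)"
          by (simp add: e_def)
      qed
      then show "(\<Sum>t\<in>{j * \<tau>..<j * \<tau> + \<tau>}. e t) = real \<tau> * min 1 (real n * (1 / 2) ^ j)"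
        by simp
    qed
    also have "\<dots> = real \<tau> * (\<Sum>j<s. min 1 (real n * (1 / 2) ^ j))"
      by (simp add: sum_distrib_left)
    also have "\<dots> \<le> real \<tau> * (real m + 2)"
      using n_le by (intro mult_left_mono sum_min_1_geometric_le) auto
    finally show ?thesis .
  qed
  have partial: "(1 - (1 - \<epsilon>) ^ (s * \<tau>)) - \<epsilon> * (real \<tau> * (real m + 2)) \<le> A" for s
  proof -
    have w: "0 \<le> \<epsilon> * (1 - \<epsilon>) ^ t" "\<epsilon> * (1 - \<epsilon>) ^ t \<le> \<epsilon>" for t
      using \<epsilon> by (auto simp: power_le_one mult_le_cancel_left1)
    have "(\<Sum>t<s * \<tau>. \<epsilon> * (1 - \<epsilon>) ^ t) = 1 - (1 - \<epsilon>) ^ (s * \<tau>)"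
      using \<epsilon> by (simp add: sum_distrib_left[symmetric] sum_gp_strict)
    moreover have "(\<Sum>t<s * \<tau>. \<epsilon> * e t) \<le> \<epsilon> * (real \<tau> * (real m + 2))"
      using sum_e \<epsilon> by (simp add: sum_distrib_left[symmetric])
    ultimately have "(1 - (1 - \<epsilon>) ^ (s * \<tau>)) - \<epsilon> * (real \<tau> * (real m + 2))
        \<le> (\<Sum>t<s * \<tau>. \<epsilon> * (1 - \<epsilon>) ^ t - \<epsilon> * e t)"
      by (simp add: sum_subtractf)
    also have "\<dots> \<le> (\<Sum>t<s * \<tau>. \<epsilon> * (1 - \<epsilon>) ^ t * (\<Sum>v\<in>?V. M t v))"
    proof (rule sum_mono)
      fix t
      have "0 \<le> e t" by (simp add: e_def)
      \<comment> \<open>The weight of each error is raised to \<open>\<epsilon>\<close>, so that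
        errors add up blockwise; the main term keeps its decaying weight.\<close>
      then have "\<epsilon> * (1 - \<epsilon>) ^ t * e t \<le> \<epsilon> * e t"
        using w(2) by (intro mult_right_mono)
      then have "\<epsilon> * (1 - \<epsilon>) ^ t - \<epsilon> * e t \<le> \<epsilon> * (1 - \<epsilon>) ^ t * (1 - e t)"
        by (simp add: right_diff_distrib)
      also have "\<dots> \<le> \<epsilon> * (1 - \<epsilon>) ^ t * (\<Sum>v\<in>?V. M t v)"
        by (intro mult_left_mono mass_t w)
      finally show "\<epsilon> * (1 - \<epsilon>) ^ t - \<epsilon> * e t \<le> \<epsilon> * (1 - \<epsilon>) ^ t * (\<Sum>v\<in>?V. M t v)" .
    qed
    also have "\<dots> = (\<Sum>v\<in>?V. \<Sum>t<s * \<tau>. \<epsilon> * (1 - \<epsilon>) ^ t * M t v)"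
      unfolding sum_distrib_left by (rule sum.swap)
    \<comment> \<open>The mixture of minima lies below the mixture for each centre, hence below the
      minimum of the PageRank vectors.\<close>
    also have "\<dots> \<le> A"
      unfolding A_def min_PR_def
    proof (intro sum_mono Min.boundedI)
      fix v x assume "v \<in> ?V" "x \<in> (\<lambda>c. pmf (PR G c \<epsilon>) v) ` L"
      then obtain c where c: "c \<in> L" and x: "x = pmf (PR G c \<epsilon>) v"
        by auto
      have "(\<Sum>t<s * \<tau>. \<epsilon> * (1 - \<epsilon>) ^ t * M t v) \<le> (\<Sum>t<s * \<tau>. \<epsilon> * (1 - \<epsilon>) ^ t * pmf (?p t c) v)"
        using finL c w by (intro sum_mono mult_left_mono) (auto simp: M_def)
      also have "\<dots> \<le> x"
        unfolding x using c L(1) by (intro PR_ge_partial_sum G \<epsilon>) auto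
      finally show "(\<Sum>t<s * \<tau>. \<epsilon> * (1 - \<epsilon>) ^ t * M t v) \<le> x" .
    qed (use finL L(2) in auto)
    finally show ?thesis .
  qed
  have "(\<lambda>s. ((1 - \<epsilon>) ^ \<tau>) ^ s) \<longlonglongrightarrow> 0"
    using \<epsilon> \<tau> by (intro LIMSEQ_power_zero) (simp add: power_less_one_iff)
  then have "(\<lambda>s. (1 - (1 - \<epsilon>) ^ (s * \<tau>)) - \<epsilon> * (real \<tau> * (real m + 2)))
      \<longlonglongrightarrow> (1 - 0) - \<epsilon> * (real \<tau> * (real m + 2))"
    by (intro tendsto_diff tendsto_const) (simp add: power_mult[symmetric] mult.commute)
  then have "1 - \<epsilon> * (real \<tau> * (real m + 2)) \<le> A"
    using partial by (intro LIMSEQ_le_const2) auto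
  moreover have "\<epsilon> * (real \<tau> * (real m + 2)) \<le> \<epsilon> * (real \<tau> * (3 + log 2 (real n)))"
    using \<epsilon> m_le by (intro mult_left_mono) auto
  ultimately show ?thesis
    by (simp add: A_def n_def mult.assoc)
qed

lemma contracts_mixing_time:
  assumes "ergodic_graph G" "pverts G \<noteq> {}"
  shows "finite_kernel.contracts (pverts G) (uniform_step G) (mixing_time G) (1 / 2)"
proof -
  have G: "web_graph G" and erg: "ergodic_chain (pverts G) (uniform_step G)"
    using assms(1) by (auto simp: ergodic_graph_def)
  interpret finite_kernel "pverts G" "uniform_step G"
    using G assms(2) by (rule finite_kernel_uniform_step)
  have "\<exists>t. \<forall>v\<in>pverts G. tv_dist (chain_dist (uniform_step G) t v) (walk_stationary G) \<le> 1 / 4"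
    using ex_mixed[OF erg, of "1 / 4"] by (simp add: walk_stationary_def)
  then have "\<forall>v\<in>pverts G.
      tv_dist (chain_dist (uniform_step G) (mixing_time G) v) (walk_stationary G) \<le> 1 / 4"
    unfolding mixing_time_def by (rule LeastI_ex)
  moreover have "set_pmf (walk_stationary G) \<subseteq> pverts G"
    using stationary_dist_stationary[OF erg] by (simp add: is_stationary_def walk_stationary_def)
  ultimately show ?thesis
    using contracts_if_tv_dist_le[of "mixing_time G" "walk_stationary G" "1 / 4"] by simp
qed

text \<open>Distinct point masses are at l1 distance 2, so mixing time 0 can occur only on a single
  vertex; this provides the positive \<open>\<tau>\<close> required for the division into
  blocks.\<close>

lemma (in finite_kernel) contracts_0_half_trivial:
  assumes "contracts 0 (1 / 2)" "u \<in> V" "w \<in> V"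
  shows "u = w"
proof (rule ccontr)
  assume "u \<noteq> w"
  then have "2 = (\<Sum>v\<in>{u, w}. \<bar>pmf (return_pmf u) v - pmf (return_pmf w) v\<bar>)"
    by simp
  also have "\<dots> \<le> l1_dist V (return_pmf u) (return_pmf w)"
    unfolding l1_dist_def using fin assms by (intro sum_mono2) auto
  also have "\<dots> \<le> 1"
    using contractsD[OF assms] by simp
  finally show False by simp
qed

section \<open>Effect of spam on PageRank\<close>

lemma uniform_step_spam_graph:
  "H \<in> spam_graphs G P \<Longrightarrow> v \<in> pverts G - P \<Longrightarrow> uniform_step H v = uniform_step G v"
  by (simp add: spam_graphs_def uniform_step_def)

text \<open>\<open>d\<close> is the loss per vertex and \<open>U\<close> the set of old vertices
  outside \<open>P\<close>. Loss is passed on from \<open>U\<close> or originates in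
  \<open>P\<close>, and each step damps it by \<open>1 - \<epsilon>\<close>; summing gives a
  self-bounding inequality that limits \<open>sum d U + sum x P\<close> to
  \<open>sum x P / \<epsilon>\<close>. Both claims follow from it.\<close>

lemma
  fixes \<epsilon> :: real
  assumes G: "web_graph G" and H: "H \<in> spam_graphs G P" and P: "P \<subseteq> pverts G"
    and c: "c \<in> pverts G" and \<epsilon>: "0 < \<epsilon>" "\<epsilon> < 1"
  shows PR_loss_le:
      "(\<Sum>v\<in>pverts G. max 0 (pmf (PR G c \<epsilon>) v - pmf (PR H c \<epsilon>) v)) \<le> (\<Sum>v\<in>P. pmf (PR G c \<epsilon>) v) / \<epsilon>"
    and PR_spam_le:
      "(\<Sum>v\<in>(pverts H - pverts G) \<union> P. pmf (PR H c \<epsilon>) v) \<le> (\<Sum>v\<in>P. pmf (PR G c \<epsilon>) v) / \<epsilon>"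
proof -
  let ?V = "pverts G" and ?W = "pverts H" and ?M = "uniform_step G" and ?N = "uniform_step H"
  define U where "U = ?V - P"
  define x y d where "x v = pmf (PR G c \<epsilon>) v" and "y v = pmf (PR H c \<epsilon>) v"
    and "d v = max 0 (x v - y v)" for v
  have H': "web_graph H" and VW: "?V \<subseteq> ?W"
    using H by (auto simp: spam_graphs_def)
  have cW: "c \<in> ?W" using c VW by auto
  have fV: "finite ?V" and fW: "finite ?W"
    using G H' by (auto simp: web_graph_finite)
  have V: "?V = U \<union> P" "U \<inter> P = {}" and W: "?W = U \<union> (?W - U)" "U \<subseteq> ?W"
    using P VW by (auto simp: U_def)
  have fU: "finite U" and fP: "finite P"
    using fV P by (auto simp: U_def intro: finite_subset)
  have d_nonneg: "0 \<le> d v" and x_nonneg: "0 \<le> x v" and y_nonneg: "0 \<le> y v" for v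
    by (simp_all add: d_def x_def y_def)
  \<comment> \<open>All of the mass \<open>x\<close> on \<open>P\<close> is charged as lost; what
    \<open>H\<close> sends in from outside \<open>U\<close> only reduces the loss and is
    dropped.\<close>
  have d_le: "d v \<le> (1 - \<epsilon>) * ((\<Sum>u\<in>U. d u * pmf (?M u) v) + (\<Sum>u\<in>P. x u * pmf (?M u) v))" for v
  proof -
    have "(\<Sum>u\<in>?V. x u * pmf (?M u) v) = (\<Sum>u\<in>U. x u * pmf (?M u) v) + (\<Sum>u\<in>P. x u * pmf (?M u) v)"
      unfolding V(1) by (rule sum.union_disjoint[OF fU fP V(2)])
    moreover have "(\<Sum>u\<in>U. y u * pmf (?M u) v) \<le> (\<Sum>u\<in>?W. y u * pmf (?N u) v)"
    proof -
      have "(\<Sum>u\<in>U. y u * pmf (?M u) v) = (\<Sum>u\<in>U. y u * pmf (?N u) v)"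
        using uniform_step_spam_graph[OF H] by (intro sum.cong) (auto simp: U_def)
      also have "\<dots> \<le> (\<Sum>u\<in>?W. y u * pmf (?N u) v)"
        using W(2) fW y_nonneg by (intro sum_mono2) auto
      finally show ?thesis .
    qed
    moreover have "(\<Sum>u\<in>U. x u * pmf (?M u) v) - (\<Sum>u\<in>U. y u * pmf (?M u) v) \<le> (\<Sum>u\<in>U. d u * pmf (?M u) v)"
      unfolding sum_subtractf[symmetric] left_diff_distrib[symmetric]
      by (intro sum_mono mult_right_mono) (auto simp: d_def)
    ultimately have le: "(\<Sum>u\<in>?V. x u * pmf (?M u) v) - (\<Sum>u\<in>?W. y u * pmf (?N u) v)
        \<le> (\<Sum>u\<in>U. d u * pmf (?M u) v) + (\<Sum>u\<in>P. x u * pmf (?M u) v)"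
      by linarith
    have "x v - y v = (1 - \<epsilon>) * ((\<Sum>u\<in>?V. x u * pmf (?M u) v) - (\<Sum>u\<in>?W. y u * pmf (?N u) v))"
      using PR_eq[OF G c \<epsilon>, of v] PR_eq[OF H' cW \<epsilon>, of v]
      unfolding x_def y_def right_diff_distrib by linarith
    also have "\<dots> \<le> (1 - \<epsilon>) * ((\<Sum>u\<in>U. d u * pmf (?M u) v) + (\<Sum>u\<in>P. x u * pmf (?M u) v))"
      using le \<epsilon> by (intro mult_left_mono) auto
    moreover have "0 \<le> (1 - \<epsilon>) * ((\<Sum>u\<in>U. d u * pmf (?M u) v) + (\<Sum>u\<in>P. x u * pmf (?M u) v))"
      using \<epsilon> d_nonneg x_nonneg by (intro mult_nonneg_nonneg add_nonneg_nonneg sum_nonneg) auto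
    ultimately show ?thesis
      by (simp add: d_def)
  qed
  have push: "(\<Sum>v\<in>?V. \<Sum>u\<in>B. g u * pmf (?M u) v) = (\<Sum>u\<in>B. g u)" if "B \<subseteq> ?V" for B g
  proof -
    have "(\<Sum>v\<in>?V. pmf (?M u) v) = 1" if "u \<in> B" for u
      using that \<open>B \<subseteq> ?V\<close> out_nbrs_subset[OF G, of u]
      by (intro sum_pmf_eq_1 fV) (simp add: set_uniform_step[OF G] subsetD)
    then show ?thesis
      by (subst sum.swap) (simp add: sum_distrib_left[symmetric])
  qed
  have "sum d ?V \<le> (\<Sum>v\<in>?V. (1 - \<epsilon>) * ((\<Sum>u\<in>U. d u * pmf (?M u) v) + (\<Sum>u\<in>P. x u * pmf (?M u) v)))"
    by (intro sum_mono d_le)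
  also have "\<dots> = (1 - \<epsilon>) * (sum d U + sum x P)"
    using push[of U d] push[of P x] P
    by (simp add: sum_distrib_left[symmetric] sum.distrib U_def)
  finally have dV: "sum d ?V \<le> (1 - \<epsilon>) * (sum d U + sum x P)" .
  have "sum d U \<le> sum d ?V"
    using fV d_nonneg by (intro sum_mono2) (auto simp: U_def)
  \<comment> \<open>Bound \<open>sum d U\<close> by the right-hand side of \<open>dV\<close> and
    collect the terms in \<open>sum d U + sum x P\<close>.\<close>
  with dV have "\<epsilon> * (sum d U + sum x P) \<le> sum x P"
    by (simp add: algebra_simps)
  then have dU: "sum d U + sum x P \<le> sum x P / \<epsilon>"
    using \<epsilon> by (simp add: field_simps)
  have "0 \<le> sum d U + sum x P"
    by (intro add_nonneg_nonneg sum_nonneg d_nonneg x_nonneg)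
  then have "sum d ?V \<le> sum d U + sum x P"
    using dV \<epsilon> by (smt (verit) mult_left_le_one_le)
  then show "(\<Sum>v\<in>?V. max 0 (pmf (PR G c \<epsilon>) v - pmf (PR H c \<epsilon>) v)) \<le> (\<Sum>v\<in>P. pmf (PR G c \<epsilon>) v) / \<epsilon>"
    using dU unfolding x_def y_def d_def by linarith
  \<comment> \<open>Both totals are 1, so the mass of \<open>y\<close> outside \<open>U\<close> is
    \<open>sum x P\<close> plus the drop \<open>sum x U - sum y U\<close>.\<close>
  have "sum x U + sum x P = 1"
    using sum.union_disjoint[OF fU fP V(2), of x] sum_pmf_eq_1[OF fV set_PR_subset[OF G c \<epsilon>]] V(1)
    by (simp add: x_def)
  moreover have "sum y U + sum y (?W - U) = 1"
    using sum.subset_diff[OF W(2) fW, of y] sum_pmf_eq_1[OF fW set_PR_subset[OF H' cW \<epsilon>]]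
    by (simp add: y_def)
  moreover have "sum x U - sum y U \<le> sum d U"
    unfolding sum_subtractf[symmetric] by (intro sum_mono) (simp add: d_def)
  ultimately have "sum y (?W - U) \<le> sum x P / \<epsilon>"
    using dU by linarith
  moreover have "?W - U = (?W - ?V) \<union> P"
    using P VW by (auto simp: U_def)
  ultimately show "(\<Sum>v\<in>(?W - ?V) \<union> P. pmf (PR H c \<epsilon>) v) \<le> (\<Sum>v\<in>P. pmf (PR G c \<epsilon>) v) / \<epsilon>"
    by (simp add: x_def y_def)
qed

section \<open>From PageRank to the normalised minimum\<close>

lemma sum_min_PR_pos:
  assumes H: "web_graph H" and L: "L \<subseteq> pverts H" "coherent H L" and \<epsilon>: "0 < \<epsilon>" "\<epsilon> < 1"
  shows "0 < (\<Sum>v\<in>pverts H. min_PR H L \<epsilon> v)"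
proof -
  have finL: "finite L"
    using L(1) web_graph_finite[OF H] by (rule finite_subset)
  obtain v where v: "v \<in> pverts H" "\<And>c. c \<in> L \<Longrightarrow> reachable (with_proj H) c v" and ne: "L \<noteq> {}"
    using L(2) by (auto simp: coherent_def)
  have "0 < min_PR H L \<epsilon> v"
    unfolding min_PR_def using finL ne L(1) v(2)
    by (subst Min_gr_iff) (auto intro!: PR_pos_if_reachable[OF H _ \<epsilon>])
  then show ?thesis
    using v(1) web_graph_finite[OF H] min_PR_nonneg[OF finL ne] by (intro sum_pos2[of _ v]) auto
qed

lemma R_min_eq:
  assumes "finite L" "L \<noteq> {}"
  shows "R_min H L \<epsilon> v = min_PR H L \<epsilon> v / (\<Sum>u\<in>pverts H. min_PR H L \<epsilon> u)"
  using min_PR_nonneg[OF assms] by (simp add: R_min_def)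

lemma ranking_vector_R_min:
  assumes H: "web_graph H" and L: "L \<subseteq> pverts H" "coherent H L" and \<epsilon>: "0 < \<epsilon>" "\<epsilon> < 1"
  shows "ranking_vector H (R_min H L \<epsilon>)"
proof -
  have finL: "finite L" and ne: "L \<noteq> {}"
    using L web_graph_finite[OF H] by (auto simp: coherent_def intro: finite_subset)
  have pos: "0 < (\<Sum>u\<in>pverts H. min_PR H L \<epsilon> u)"
    by (rule sum_min_PR_pos[OF assms])
  have "min_PR H L \<epsilon> v \<le> (\<Sum>u\<in>pverts H. min_PR H L \<epsilon> u)" if "v \<in> pverts H" for v
    using that web_graph_finite[OF H] min_PR_nonneg[OF finL ne] by (intro member_le_sum) auto
  then show ?thesis
    using pos min_PR_nonneg[OF finL ne]
    by (simp add: ranking_vector_def R_min_eq[OF finL ne] sum_divide_distrib[symmetric])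
qed

text \<open>The minimising centre in \<open>H\<close> may vary with the vertex, so the losses of all
  centres in \<open>L\<close> have to be added; this sum is the origin of the factor
  \<open>k\<close>.\<close>

lemma R_min_spam_le:
  fixes \<epsilon> :: real
  assumes erg: "ergodic_graph G" and \<epsilon>: "0 < \<epsilon>" "\<epsilon> < 1"
    and mix: "real (mixing_time G) \<le> 1 / (3 * \<epsilon> * (3 + log 2 (real (card (pverts G)))))"
    and P: "P \<subseteq> pverts G" and L: "L \<subseteq> pverts G - P" "coherent H L"
    and H: "H \<in> spam_graphs G P"
  shows "\<epsilon> * (\<Sum>v\<in>(pverts H - pverts G) \<union> P. R_min H L \<epsilon> v) \<le> 3 * (\<Sum>c\<in>L. \<Sum>v\<in>P. pmf (PR G c \<epsilon>) v)"
proof -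
  let ?V = "pverts G" and ?W = "pverts H"
  define S where "S = (?W - ?V) \<union> P"
  define X where "X = (\<Sum>c\<in>L. \<Sum>v\<in>P. pmf (PR G c \<epsilon>) v)"
  define Y where "Y = (\<Sum>v\<in>?W. min_PR H L \<epsilon> v)"
  have G: "web_graph G" and H': "web_graph H" and VW: "?V \<subseteq> ?W"
    using erg H by (auto simp: ergodic_graph_def spam_graphs_def)
  have fV: "finite ?V" and fW: "finite ?W"
    using G H' by (auto simp: web_graph_finite)
  have LV: "L \<subseteq> ?V" and LW: "L \<subseteq> ?W" using L(1) VW by auto
  have finL: "finite L" and ne: "L \<noteq> {}"
    using LV L(2) fV by (auto simp: coherent_def intro: finite_subset)
  have SW: "S \<subseteq> ?W" using P VW by (auto simp: S_def)
  have Y_pos: "0 < Y"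
    unfolding Y_def by (rule sum_min_PR_pos[OF H' LW L(2) \<epsilon>])
  define F where "F = (\<Sum>v\<in>S. R_min H L \<epsilon> v)"
  have F: "F = (\<Sum>v\<in>S. min_PR H L \<epsilon> v) / Y"
    by (simp add: F_def R_min_eq[OF finL ne] Y_def sum_divide_distrib)
  have S_nonneg: "0 \<le> (\<Sum>v\<in>S. min_PR H L \<epsilon> v)"
    by (intro sum_nonneg min_PR_nonneg finL ne)
  then have F_nonneg: "0 \<le> F"
    using Y_pos by (simp add: F)
  have "(\<Sum>v\<in>S. min_PR H L \<epsilon> v) \<le> Y"
    unfolding Y_def using fW SW min_PR_nonneg[OF finL ne] by (intro sum_mono2) auto
  then have F_le_1: "F \<le> 1"
    using Y_pos by (simp add: F)
  have X_part: "(\<Sum>v\<in>P. pmf (PR G c \<epsilon>) v) \<le> X" if "c \<in> L" for c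
    unfolding X_def using that finL
    by (intro member_le_sum[of c L "\<lambda>c. \<Sum>v\<in>P. pmf (PR G c \<epsilon>) v"]) (auto intro: sum_nonneg)
  obtain b where b: "b \<in> L" using ne by auto
  have "(\<Sum>v\<in>S. min_PR H L \<epsilon> v) \<le> (\<Sum>v\<in>S. pmf (PR H b \<epsilon>) v)"
    unfolding min_PR_def using finL b by (intro sum_mono Min_le) auto
  also have "\<dots> \<le> (\<Sum>v\<in>P. pmf (PR G b \<epsilon>) v) / \<epsilon>"
    unfolding S_def using b LV by (intro PR_spam_le G H P \<epsilon>) auto
  also have "\<dots> \<le> X / \<epsilon>"
    using X_part[OF b] \<epsilon> by (intro divide_right_mono) auto
  finally have S_le: "(\<Sum>v\<in>S. min_PR H L \<epsilon> v) \<le> X / \<epsilon>" .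
  have "\<epsilon> * F \<le> 3 * X"
  \<comment> \<open>Empty \<open>P\<close> is split off so that afterwards a vertex \<open>a\<close>
    of \<open>P\<close> exists; it differs from the centre \<open>b\<close>, which excludes mixing
    time 0.\<close>
  proof (cases "P = {} \<or> \<epsilon> / 3 \<le> X")
    case True
    then show ?thesis
    proof
      assume "P = {}"
      then have "X = 0" by (simp add: X_def)
      then have "(\<Sum>v\<in>S. min_PR H L \<epsilon> v) = 0"
        using S_le S_nonneg by simp
      then show ?thesis
        using \<open>X = 0\<close> by (simp add: F)
    next
      assume "\<epsilon> / 3 \<le> X"
      moreover have "\<epsilon> * F \<le> \<epsilon>" using F_le_1 \<epsilon> by simp
      ultimately show ?thesis by linarith
    qed
  next
    case False
    then obtain a where a: "a \<in> P" and X_small: "X < \<epsilon> / 3" by auto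
    have V_ne: "?V \<noteq> {}" using a P by auto
    interpret finite_kernel ?V "uniform_step G"
      using G V_ne by (rule finite_kernel_uniform_step)
    have contr: "contracts (mixing_time G) (1 / 2)"
      by (rule contracts_mixing_time[OF erg V_ne])
    have \<tau>: "0 < mixing_time G"
    proof (rule ccontr)
      assume "\<not> 0 < mixing_time G"
      then have "a = b"
        using contr a b P LV by (intro contracts_0_half_trivial) auto
      then show False using a b L(1) by auto
    qed
    have "1 \<le> card ?V"
      using fV V_ne by (simp add: Suc_le_eq card_gt_0_iff)
    then have "0 < 3 * \<epsilon> * (3 + log 2 (real (card ?V)))"
      using \<epsilon> by (simp add: add_pos_nonneg)
    then have "real (mixing_time G) * (3 * \<epsilon> * (3 + log 2 (real (card ?V)))) \<le> 1"
      using mix by (simp add: pos_le_divide_eq)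
    then have "\<epsilon> * real (mixing_time G) * (3 + log 2 (real (card ?V))) \<le> 1 / 3"
      by (simp add: algebra_simps)
    then have "2 / 3 \<le> (\<Sum>v\<in>?V. min_PR G L \<epsilon> v)"
      using sum_min_PR_ge[OF G \<epsilon> LV ne \<tau> contr] by linarith
    also have "\<dots> \<le> (\<Sum>v\<in>?V. min_PR H L \<epsilon> v + (\<Sum>c\<in>L. max 0 (pmf (PR G c \<epsilon>) v - pmf (PR H c \<epsilon>) v)))"
    proof (rule sum_mono)
      fix v
      have "min_PR H L \<epsilon> v \<in> (\<lambda>c. pmf (PR H c \<epsilon>) v) ` L"
        unfolding min_PR_def using finL ne by (intro Min_in) auto
      then obtain c where c: "c \<in> L" "min_PR H L \<epsilon> v = pmf (PR H c \<epsilon>) v"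
        by auto
      have "min_PR G L \<epsilon> v \<le> pmf (PR G c \<epsilon>) v"
        unfolding min_PR_def using finL c(1) by (intro Min_le) auto
      moreover have "max 0 (pmf (PR G c \<epsilon>) v - pmf (PR H c \<epsilon>) v)
          \<le> (\<Sum>c\<in>L. max 0 (pmf (PR G c \<epsilon>) v - pmf (PR H c \<epsilon>) v))"
        using c(1) finL by (intro member_le_sum) auto
      ultimately show "min_PR G L \<epsilon> v
          \<le> min_PR H L \<epsilon> v + (\<Sum>c\<in>L. max 0 (pmf (PR G c \<epsilon>) v - pmf (PR H c \<epsilon>) v))"
        using c(2) by linarith
    qed
    also have "\<dots> = (\<Sum>v\<in>?V. min_PR H L \<epsilon> v)
        + (\<Sum>c\<in>L. \<Sum>v\<in>?V. max 0 (pmf (PR G c \<epsilon>) v - pmf (PR H c \<epsilon>) v))"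
      unfolding sum.distrib by (subst (2) sum.swap) simp
    also have "\<dots> \<le> Y + (\<Sum>c\<in>L. (\<Sum>v\<in>P. pmf (PR G c \<epsilon>) v) / \<epsilon>)"
      unfolding Y_def using fW VW min_PR_nonneg[OF finL ne] LV
      by (intro add_mono sum_mono2 sum_mono PR_loss_le G H P \<epsilon>) auto
    also have "\<dots> = Y + X / \<epsilon>"
      by (simp add: X_def sum_divide_distrib)
    also have "X / \<epsilon> \<le> 1 / 3"
      using X_small \<epsilon> by (simp add: field_simps)
    \<comment> \<open>Of the mass 2/3 common in \<open>G\<close> at most 1/3 is lost, so normalising
      costs at most a factor 3.\<close>
    finally have "1 / 3 \<le> Y" by simp
    then have "F * (1 / 3) \<le> F * Y"
      using F_nonneg by (intro mult_left_mono)
    also have "\<dots> \<le> X / \<epsilon>"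
      using S_le Y_pos by (simp add: F)
    finally show ?thesis
      using \<epsilon> by (simp add: field_simps)
  qed
  then show ?thesis
    by (simp add: F_def S_def X_def)
qed

section \<open>The cost function and spam resistance\<close>

theorem theorem11:
  fixes \<epsilon> :: real and k :: nat
    and f :: "'a pair_pre_digraph \<Rightarrow> 'a set \<Rightarrow> 'a \<Rightarrow> real"
  assumes "0 < \<epsilon>" and "\<epsilon> < 1" and "0 < k"
    and "T_Min_PPR k \<epsilon> f"
  shows "spam_resistant (\<epsilon> / (3 * real k))
           {G. ergodic_graph G \<and>
               real (mixing_time G) \<le> 1 / (3 * \<epsilon> * (3 + log 2 (real (card (pverts G)))))} f"
proof -
  obtain sel where
    sel: "\<And>T. finite T \<Longrightarrow> T \<noteq> {} \<Longrightarrow> sel T \<subseteq> T \<and> card (sel T) = min k (card T)" and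
    f: "\<And>H T. ranking_input H T \<Longrightarrow>
      \<exists>L. max_coherent_subset H (sel T) L \<and> (\<forall>v\<in>pverts H. f H T v = R_min H L \<epsilon> v)"
    using assms(4) unfolding T_Min_PPR_def by metis
  have f_cases: "\<exists>L. L \<subseteq> sel T \<and> sel T \<subseteq> T \<and> coherent H L \<and> (\<forall>v\<in>pverts H. f H T v = R_min H L \<epsilon> v)"
    if "ranking_input H T" for H T
    using f[OF that] sel[of T] that finite_subset[OF _ web_graph_finite[of H]]
    unfolding max_coherent_subset_def ranking_input_def by metis
  have "ranking_vector H (f H T)" if inp: "ranking_input H T" for H T
  proof -
    obtain L where L: "L \<subseteq> sel T" "sel T \<subseteq> T" "coherent H L" "\<forall>v\<in>pverts H. f H T v = R_min H L \<epsilon> v"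
      using f_cases[OF inp] by auto
    have "ranking_vector H (R_min H L \<epsilon>)"
      using inp L(1-3) assms(1,2) by (intro ranking_vector_R_min) (auto simp: ranking_input_def)
    then show ?thesis
      using L(4) by (simp add: ranking_vector_def)
  qed
  then have alg: "ranking_algorithm f"
    by (simp add: ranking_algorithm_def)
  have "\<exists>C. cost_function G T C \<and>
           (\<forall>P H. P \<subseteq> pverts G - T \<and> H \<in> spam_graphs G P \<and>
              (\<Sum>v\<in>(pverts H - pverts G) \<union> P. f H T v) > 0 \<longrightarrow>
              (\<Sum>v\<in>P. C v) / (\<Sum>v\<in>(pverts H - pverts G) \<union> P. f H T v) \<ge> \<epsilon> / (3 * real k))"
    if erg: "ergodic_graph G"
      and mix: "real (mixing_time G) \<le> 1 / (3 * \<epsilon> * (3 + log 2 (real (card (pverts G)))))"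
      and T: "T \<noteq> {}" "T \<subseteq> pverts G" for G T
  proof -
    let ?V = "pverts G" and ?x = "\<lambda>c v. pmf (PR G c \<epsilon>) v"
    have G: "web_graph G"
      using erg by (simp add: ergodic_graph_def)
    have fV: "finite ?V"
      by (rule web_graph_finite[OF G])
    have fT: "finite T"
      using T(2) fV by (rule finite_subset)
    \<comment> \<open>\<open>K\<close> is determined by \<open>T\<close> alone, so the costs can be
      fixed before \<open>P\<close> and \<open>H\<close> are known; the coherent subset chosen in
      \<open>H\<close> always lies in \<open>K\<close>.\<close>
    define K where "K = sel T"
    have K: "K \<subseteq> T" "card K \<le> k"
      using sel[OF fT T(1)] by (auto simp: K_def)
    have fK: "finite K"
      using K(1) fT by (rule finite_subset)
    \<comment> \<open>As \<open>card K\<close> is at most \<open>k\<close>, division by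
      \<open>k\<close> keeps the total at most 1, and the sum over the centres is exactly
      \<open>real k * s v\<close>.\<close>
    define s where "s v = (\<Sum>c\<in>K. ?x c v) / real k" for v
    \<comment> \<open>The mass of the averaged PageRank vector outside \<open>V - T\<close> is spread evenly to make the
      costs sum to 1.\<close>
    define C where "C v = s v + (1 - sum s (?V - T)) / real (card (?V - T))" for v
    have s_nonneg: "0 \<le> s v" for v
      by (simp add: s_def sum_nonneg)
    have "sum s (?V - T) \<le> sum s ?V"
      using fV s_nonneg by (intro sum_mono2) auto
    also have "\<dots> = (\<Sum>c\<in>K. \<Sum>v\<in>?V. ?x c v) / real k"
      unfolding s_def sum_divide_distrib[symmetric] by (subst sum.swap) simp
    also have "\<dots> = real (card K) / real k"
    proof -
      have "(\<Sum>v\<in>?V. ?x c v) = 1" if "c \<in> K" for c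
        using that K T assms by (intro sum_pmf_eq_1 fV set_PR_subset G) auto
      then show ?thesis by simp
    qed
    also have "\<dots> \<le> 1"
      using K(2) assms(3) by simp
    finally have s_le_1: "sum s (?V - T) \<le> 1" .
    \<comment> \<open>If \<open>?V - T\<close> is empty, the added share is a division by 0, hence
      0.\<close>
    then have C_ge: "s v \<le> C v" for v
      by (simp add: C_def)
    have "cost_function G T C"
      unfolding cost_function_def
    proof (intro conjI ballI impI)
      fix v show "0 \<le> C v"
        using s_nonneg[of v] C_ge[of v] by linarith
    next
      assume "?V - T \<noteq> {}"
      then have "card (?V - T) \<noteq> 0"
        using fV by simp
      then show "sum C (?V - T) = 1"
        by (simp add: C_def sum.distrib)
    qed
    moreover have "\<epsilon> / (3 * real k) \<le> (\<Sum>v\<in>P. C v) / (\<Sum>v\<in>(pverts H - ?V) \<union> P. f H T v)"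
      if P: "P \<subseteq> ?V - T" and H: "H \<in> spam_graphs G P"
        and pos: "0 < (\<Sum>v\<in>(pverts H - ?V) \<union> P. f H T v)" for P H
    proof -
      have inp: "ranking_input H T"
        using H T by (auto simp: ranking_input_def spam_graphs_def)
      obtain L where L: "L \<subseteq> K" "coherent H L" "\<forall>v\<in>pverts H. f H T v = R_min H L \<epsilon> v"
        using f_cases[OF inp] by (auto simp: K_def)
      have sub: "(pverts H - ?V) \<union> P \<subseteq> pverts H"
        using P H by (auto simp: spam_graphs_def)
      have "\<epsilon> * (\<Sum>v\<in>(pverts H - ?V) \<union> P. f H T v)
          = \<epsilon> * (\<Sum>v\<in>(pverts H - ?V) \<union> P. R_min H L \<epsilon> v)"
        using sub L(3) by (intro arg_cong[where f = "(*) \<epsilon>"] sum.cong) auto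
      also have "\<dots> \<le> 3 * (\<Sum>c\<in>L. \<Sum>v\<in>P. ?x c v)"
        using P L(1) K(1) T(2) assms by (intro R_min_spam_le erg mix L(2) H) auto
      \<comment> \<open>\<open>L\<close> depends on \<open>H\<close>; enlarging it to
        \<open>K\<close> reaches the costs fixed in advance.\<close>
      also have "(\<Sum>c\<in>L. \<Sum>v\<in>P. ?x c v) \<le> (\<Sum>c\<in>K. \<Sum>v\<in>P. ?x c v)"
        using fK L(1) by (intro sum_mono2) (auto intro: sum_nonneg)
      also have "\<dots> = real k * sum s P"
        using assms(3) unfolding s_def sum_divide_distrib[symmetric] by (subst sum.swap) simp
      also have "\<dots> \<le> real k * sum C P"
        by (intro mult_left_mono sum_mono C_ge) simp
      finally show ?thesis
        using pos assms(3) by (simp add: field_simps)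
    qed
    ultimately show ?thesis by blast
  qed
  then show ?thesis
    using alg unfolding spam_resistant_def by simp
qed

end
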